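(* In the setting of the context (nonlinear system, nominal trajectory, uncertainty bounds, time nodes, matrices $H^k_{i,j}$), fix $\lambda_w>0$, $Q_{max}\succ0$ and a convex cost $J$, and consider the semidefinite program: minimize $J(Q_0,\dots,Q_N)$ over $Q_k=Q_k^\top\in\mathbb{R}^{n_x\times n_x}$, $Y_k\in\mathbb{R}^{n_u\times n_x}$, positive scalars $(\lambda_{\beta_\eta})_k,(\lambda_{\beta_\xi})_k,(\lambda_{\beta_w})_k,(\lambda_\gamma)_k$ ($k=0,\dots,N$) and matrices $X^k_{i,j}$ ($i,j\in\{k,k+1\}$, $k=0,\dots,N-1$), subject to: (1) for every $k=0,\dots,N-1$, either (a) holds or (b) holds, where (a) $H^k_{k,k}\succeq0$, $H^k_{k+1,k+1}\succeq0$, $H^k_{k,k+1}+H^k_{k+1,k}\succeq0$; (b) $X^k_{i,j}=(X^k_{j,i})^\top\succeq0$ for all $i,j\in\{k,k+1\}$, and $$\begin{bmatrix} H^k_{k,k}-X^k_{k,k} & \left(\tfrac12(H^k_{k,k+1}+H^k_{k+1,k})-X^k_{k+1,k}\right)^\top \\ \tfrac12(H^k_{k,k+1}+H^k_{k+1,k})-X^k_{k+1,k} & H^k_{k+1,k+1}-X^k_{k+1,k+1} \end{bmatrix}\succeq0;$$ (2) for every $k=0,\dots,N$, $i=1,\dots,m_x$, $j=1,\dots,m_u$, $$\begin{bmatrix} (b^h_i-(a^h_i)^\top\bar x(t_k))^2 & (a^h_i)^\top Q_k \\ Q_k a^h_i & Q_k \end{bmatrix}\succeq0,\qquad \begin{bmatrix}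 (b^g_j-(a^g_j)^\top\bar u(t_k))^2 & (a^g_j)^\top Y_k \\ Y_k^\top a^g_j & Q_k \end{bmatrix}\succeq0;$$ (3) $0\prec Q_k\preceq Q_{max}$ for every $k=0,\dots,N$. Let $Q(t)$ and $Y(t)$ be obtained from a solution of this program by first-order-hold interpolation, i.e. $Q(t)=\sigma^k_1(t)Q_k+\sigma^k_2(t)Q_{k+1}$ and $Y(t)=\sigma_1^k(t)Y_k+\sigma_2^k(t)Y_{k+1}$ for $t\in[t_k,t_{k+1}]$, and let $K(t)=Y(t)Q(t)^{-1}$. Then the funnel $$\mathcal F(t)=\left(\{\bar x(t)\}\oplus\mathcal E_Q(t)\right)\times\left(\{\bar u(t)\}\oplus\mathcal E_{KQK^\top}(t)\right)$$ is invariant on $[t_0,t_f]$ for the nonlinear system $\dot x=f(t,x,u,w)$: for every admissible disturbance $w(\cdot)$, if $x(\cdot)$ is a solution on $[t_0,t_f]$ with $x(t_0)\in\{\bar x(t_0)\}\oplus\mathcal E_Q(t_0)$ under the control law $u(t)=\bar u(t)+K(t)(x(t)-\bar x(t))$, then $(x(t),u(t))\in\mathcal F(t)$ for all $t\in[t_0,t_f]$.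
   Context: **Nonlinear system.** $\dot x(t)=f(t,x(t),u(t),w(t))$ on $[t_0,t_f]$, with $x\in\mathbb{R}^{n_x}$, $u\in\mathbb{R}^{n_u}$, $w\in\mathbb{R}^{n_w}$; $f$ is continuous in $t$ and continuously differentiable in $(x,u,w)$. Inputs are piecewise continuous. A disturbance $w(\cdot)$ is admissible if it is piecewise continuous with $\operatorname{ess\,sup}_{t\in[t_0,t_f]}\|w(t)\|_2\le1$. A nominal trajectory $(\bar x,\bar u,0)$ is given with $\dot{\bar x}=f(t,\bar x,\bar u,0)$. With $A(t),B(t),F(t)$ the (bounded) partial Jacobians of $f$ in $x,u,w$ along the nominal trajectory, $f$ is written as $f(t,x,u,w)=A(t)x+B(t)u+F(t)w+E_o\phi(t,q)$, $q=C_ox+D_ou+G_ow$, where $E_o,C_o,D_o,G_o$ are constant matrices and $\phi:\mathbb{R}_+\times\mathbb{R}^{n_q}\to\mathbb{R}^{n_\phi}$. Put $\bar q=C_o\bar x+D_o\bar u$. **Time nodes and interpolation.** $t_k=t_0+\frac kN(t_f-t_0)$, $k=0,\dots,N$; on $[t_k,t_{k+1}]$, $\sigma^k_1(t)=\frac{t_{k+1}-t}{t_{k+1}-t_k}$ and $\sigma^k_2(t)=\frac{t-t_k}{t_{k+1}-t_k}$. For $\square\in\{A,B,F\}$: $\square_k=\square(t_k)$ and $\tilde\square(t)=\sigma^k_1(t)\square_k+\sigma^k_2(t)\square_{k+1}$ on $[t_k,t_{k+1}]$. **Interpolation error.** Constant matrices $E_\eta,E_\xi,E_w,C_\eta,D_\xi,G_w$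 and matrix functions $\Delta_\eta(t),\Delta_\xi(t),\Delta_w(t)$ are given with $A-\tilde A=E_\eta\Delta_\eta C_\eta$, $B-\tilde B=E_\xi\Delta_\xi D_\xi$, $F-\tilde F=E_w\Delta_wG_w$ for all $t$. **Bounds.** For $\square\in\{\eta,\xi,w\}$, $\beta_\square(t)>0$ satisfies $\|\Delta_\square(t)\|_2\le\beta_\square(t)$ (spectral norm). For $i=1,\dots,n_\phi$, $\gamma_i(t)>0$ satisfies $|\phi_i(t,q)-\phi_i(t,q')|\le\gamma_i(t)\|q-q'\|_2$ for all $q,q'\in\mathcal Q$, where $\mathcal Q\subset\mathbb{R}^{n_q}$ is a compact set containing $\bar q(t)$ and the values $q(t)=C_ox(t)+D_ou(t)+G_ow(t)$ of all closed-loop trajectories under consideration. For $k=0,\dots,N-1$ put $(\gamma_i)_k=\sup_{[t_k,t_{k+1}]}\gamma_i$ and $(\beta_\square)_k=\sup_{[t_k,t_{k+1}]}\beta_\square$ (finite), and $\Gamma_k=\mathrm{diag}((\gamma_1)_k,\dots,(\gamma_{n_\phi})_k)$. **Stacked matrices.** $E=[E_\eta\ E_\xi\ E_w\ E_o]$ and, in block rows, $C=[C_\eta;0;0;C_o]$, $D=[0;D_\xi;0;D_o]$, $G=[0;0;G_w;G_o]$. **Matrices $H^k_{i,j}$.** For $k=0,\dots,N-1$ and $i,j\in\{k,k+1\}$ ($\star$ denotes entries determined by symmetry): $$H^k_{i,j}=-\begin{bmatrix} W_{i,j}-\dot Q^k & \star & \star & \star \\ N^k_{2,j}E^\top & -N^k_{2,j}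 & \star & \star \\ F_j^\top & 0 & -\lambda_wI & \star \\ C Q_j+D Y_j & 0 & G & -N_{1,j} \end{bmatrix},$$ where $\dot Q^k=\frac{Q_{k+1}-Q_k}{t_{k+1}-t_k}$, $W_{i,j}=A_iQ_j+B_iY_j+Q_jA_i^\top+Y_j^\top B_i^\top+\lambda_wQ_j$, $N_{1,j}=\mathrm{diag}((\lambda_{\beta_\eta})_jI,(\lambda_{\beta_\xi})_jI,(\lambda_{\beta_w})_jI,\frac1{n_\phi}(\lambda_\gamma)_jI_{n_q})$, and $N^k_{2,j}=\mathrm{diag}((\beta_\eta)_k^2(\lambda_{\beta_\eta})_jI,(\beta_\xi)_k^2(\lambda_{\beta_\xi})_jI,(\beta_w)_k^2(\lambda_{\beta_w})_jI,(\lambda_\gamma)_j\Gamma_k^2)$; identity blocks have the sizes conforming to the block structure of $C$ (for $N_{1,j}$) and of $E$ (for $N^k_{2,j}$). **Constraint data.** $a^h_i\in\mathbb{R}^{n_x}$, $b^h_i\in\mathbb{R}$ ($i=1,\dots,m_x$) and $a^g_j\in\mathbb{R}^{n_u}$, $b^g_j\in\mathbb{R}$ ($j=1,\dots,m_u$) define the state and input polytopes $\{x:(a_i^h)^\top x\le b_i^h\ \forall i\}$ and $\{u:(a_j^g)^\top u\le b_j^g\ \forall j\}$. **Funnels.** $\mathcal E_Q(t)=\{\eta\in\mathbb{R}^{n_x}:\eta^\top Q(t)^{-1}\eta\le1\}$, $\mathcal E_{KQK^\top}(t)=\{(K(t)Q(t)K(t)^\top)^{1/2}y:y\in\mathbb{R}^{n_u},\|y\|_2\le1\}$;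 $\oplus$ is the Minkowski sum. $M\succeq0$ ($\succ0$) means symmetric positive semidefinite (definite). *)

theory Defs
  imports
    "HOL-Analysis.Analysis"
    "HOL-Library.Set_Algebras"
    "HOL-Probability.Essential_Supremum"
begin

section \<open>Matrices\<close>

text \<open>
  A real \<open>m \<times> n\<close> matrix has type \<^typ>\<open>real^'n^'m\<close> (columns first); \<^term>\<open>mat c\<close> is \<open>c\<close> times the
  identity. The instance norm of this type is the Frobenius norm, so the spectral norm is written
  \<^term>\<open>onorm ((*v) M)\<close>. Block matrices are indexed by sum types.
\<close>

definition hcat :: "'a^'n^'m \<Rightarrow> 'a^'p^'m \<Rightarrow> 'a^('n + 'p)^'m"  (infixr \<open>|||\<close> 64) where
  "L ||| R = (\<chi> i j. case j of Inl a \<Rightarrow> L $ i $ a | Inr b \<Rightarrow> R $ i $ b)"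

definition vcat :: "'a^'n^'m \<Rightarrow> 'a^'n^'p \<Rightarrow> 'a^'n^('m + 'p)"  (infixr \<open>'/'/'/\<close> 62) where
  "U /// L = (\<chi> i. case i of Inl a \<Rightarrow> U $ a | Inr b \<Rightarrow> L $ b)"

definition block_diag :: "real^'n^'m \<Rightarrow> real^'p^'q \<Rightarrow> real^('n + 'p)^('m + 'q)" where
  "block_diag U L = ((U ||| 0) /// (0 ||| L))"

definition diag_mat :: "real^'n \<Rightarrow> real^'n^'n" where
  "diag_mat v = (\<chi> i j. if i = j then v $ i else 0)"

definition psd :: "real^'n^'n \<Rightarrow> bool" where
  "psd M \<longleftrightarrow> transpose M = M \<and> (\<forall>v. 0 \<le> v \<bullet> (M *v v))"

definition pd :: "real^'n^'n \<Rightarrow> bool" where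
  "pd M \<longleftrightarrow> transpose M = M \<and> (\<forall>v. v \<noteq> 0 \<longrightarrow> 0 < v \<bullet> (M *v v))"

definition mat_sqrt :: "real^'n^'n \<Rightarrow> real^'n^'n" where
  "mat_sqrt M = (THE R. psd R \<and> R ** R = M)"


section \<open>Piecewise continuous signals and solutions\<close>

text \<open>
  Continuous except at finitely many points, with one-sided limits everywhere. The values at the
  points of discontinuity are arbitrary.
\<close>

definition piecewise_continuous_on :: "real \<Rightarrow> real \<Rightarrow> (real \<Rightarrow> 'v::topological_space) \<Rightarrow> bool" where
  "piecewise_continuous_on a b g \<longleftrightarrow>
     (\<exists>S. finite S \<and> (\<forall>t\<in>{a..b} - S. continuous (at t within {a..b}) g)) \<and>
     (\<forall>t\<in>{a..b}. (\<exists>l. (g \<longlongrightarrow> l) (at t within {a..<t})) \<and> (\<exists>l. (g \<longlongrightarrow> l) (at t within {t<..b})))"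

definition admissible :: "real \<Rightarrow> real \<Rightarrow> (real \<Rightarrow> real^'w) \<Rightarrow> bool" where
  "admissible a b w \<longleftrightarrow> piecewise_continuous_on a b w \<and>
     esssup (lebesgue_on {a..b}) (\<lambda>t. ereal (norm (w t))) \<le> 1"

text \<open>
  Since inputs may jump, the differential equation is required outside a finite set of times.
\<close>

definition solves_on ::
  "(real \<Rightarrow> real^'x \<Rightarrow> real^'u \<Rightarrow> real^'w \<Rightarrow> real^'x) \<Rightarrow> real \<Rightarrow> real \<Rightarrow>
   (real \<Rightarrow> real^'x) \<Rightarrow> (real \<Rightarrow> real^'u) \<Rightarrow> (real \<Rightarrow> real^'w) \<Rightarrow> bool" where
  "solves_on f a b x u w \<longleftrightarrow> continuous_on {a..b} x \<and>
     (\<exists>S. finite S \<and> (\<forall>t\<in>{a..b} - S.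
        (x has_vector_derivative f t (x t) (u t) (w t)) (at t within {a..b})))"

definition C1_map :: "('a::real_normed_vector \<Rightarrow> 'b::real_normed_vector) \<Rightarrow> bool" where
  "C1_map g \<longleftrightarrow> (\<exists>g'. (\<forall>z. (g has_derivative blinfun_apply (g' z)) (at z)) \<and> continuous_on UNIV g')"


section \<open>The semidefinite program\<close>

text \<open>
  Index types: \<open>'x\<close>, \<open>'u\<close>, \<open>'w\<close> for state, input and disturbance, \<open>'q\<close> and \<open>'p\<close> for the argument
  and value of \<open>\<phi>\<close>, \<open>'e1\<close>, \<open>'e2\<close>, \<open>'e3\<close> for the columns of \<open>E\<^sub>\<eta>\<close>, \<open>E\<^sub>\<xi>\<close>, \<open>E\<^sub>w\<close>, and \<open>'c1\<close>, \<open>'c2\<close>,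
  \<open>'c3\<close> for the rows of \<open>C\<^sub>\<eta>\<close>, \<open>D\<^sub>\<xi>\<close>, \<open>G\<^sub>w\<close>. The half-spaces are numbered from \<open>1\<close>. The cost takes
  the list \<open>[Q\<^sub>0, \<dots>, Q\<^sub>N]\<close>.
\<close>

record ('x, 'u, 'w, 'q, 'p, 'e1, 'e2, 'e3, 'c1, 'c2, 'c3) sdp_data =
  t_init :: real
  t_final :: real
  num_int :: nat
  xbar :: "real \<Rightarrow> real^'x"
  ubar :: "real \<Rightarrow> real^'u"
  A_jac :: "real \<Rightarrow> real^'x^'x"
  B_jac :: "real \<Rightarrow> real^'u^'x"
  F_jac :: "real \<Rightarrow> real^'w^'x"
  E_eta :: "real^'e1^'x"
  E_xi :: "real^'e2^'x"
  E_w :: "real^'e3^'x"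
  E_o :: "real^'p^'x"
  C_eta :: "real^'x^'c1"
  D_xi :: "real^'u^'c2"
  G_w :: "real^'w^'c3"
  C_o :: "real^'x^'q"
  D_o :: "real^'u^'q"
  G_o :: "real^'w^'q"
  beta_eta :: "real \<Rightarrow> real"
  beta_xi :: "real \<Rightarrow> real"
  beta_w :: "real \<Rightarrow> real"
  gam :: "real \<Rightarrow> real^'p"
  num_h :: nat
  a_h :: "nat \<Rightarrow> real^'x"
  b_h :: "nat \<Rightarrow> real"
  num_g :: nat
  a_g :: "nat \<Rightarrow> real^'u"
  b_g :: "nat \<Rightarrow> real"
  lam_w :: real
  Q_max :: "real^'x^'x"
  cost :: "(real^'x^'x) list \<Rightarrow> real"

text \<open>
  The decision variables; \<open>X_var v k i j\<close> is \<open>X\<^sup>k\<close> with lower indices \<open>i\<close>, \<open>j\<close>.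
\<close>

record ('x, 'u, 'h) sdp_vars =
  Q_var :: "nat \<Rightarrow> real^'x^'x"
  Y_var :: "nat \<Rightarrow> real^'x^'u"
  lam_beta_eta :: "nat \<Rightarrow> real"
  lam_beta_xi :: "nat \<Rightarrow> real"
  lam_beta_w :: "nat \<Rightarrow> real"
  lam_gam :: "nat \<Rightarrow> real"
  X_var :: "nat \<Rightarrow> nat \<Rightarrow> nat \<Rightarrow> real^'h^'h"

type_synonym ('x, 'w, 'q, 'p, 'e1, 'e2, 'e3, 'c1, 'c2, 'c3) H_index =
  "'x + ('e1 + 'e2 + 'e3 + 'p) + 'w + ('c1 + 'c2 + 'c3 + 'q)"

definition horizon ::
  "('x::finite, 'u::finite, 'w::finite, 'q::finite, 'p::finite, 'e1::finite, 'e2::finite,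
    'e3::finite, 'c1::finite, 'c2::finite, 'c3::finite) sdp_data \<Rightarrow> real set" where
  "horizon P = {t_init P..t_final P}"

definition node ::
  "('x::finite, 'u::finite, 'w::finite, 'q::finite, 'p::finite, 'e1::finite, 'e2::finite,
    'e3::finite, 'c1::finite, 'c2::finite, 'c3::finite) sdp_data \<Rightarrow> nat \<Rightarrow> real" where
  "node P k = t_init P + real k / real (num_int P) * (t_final P - t_init P)"

definition seg ::
  "('x::finite, 'u::finite, 'w::finite, 'q::finite, 'p::finite, 'e1::finite, 'e2::finite,
    'e3::finite, 'c1::finite, 'c2::finite, 'c3::finite) sdp_data \<Rightarrow> nat \<Rightarrow> real set" where
  "seg P k = {node P k..node P (Suc k)}"

definition is_foh ::
  "('x::finite, 'u::finite, 'w::finite, 'q::finite, 'p::finite, 'e1::finite, 'e2::finite,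
    'e3::finite, 'c1::finite, 'c2::finite, 'c3::finite) sdp_data
   \<Rightarrow> (nat \<Rightarrow> 'v::real_vector) \<Rightarrow> (real \<Rightarrow> 'v) \<Rightarrow> bool" where
  "is_foh P M g \<longleftrightarrow> (\<forall>k<num_int P. \<forall>t\<in>seg P k.
     g t = ((node P (Suc k) - t) / (node P (Suc k) - node P k)) *\<^sub>R M k
         + ((t - node P k) / (node P (Suc k) - node P k)) *\<^sub>R M (Suc k))"

definition E_stack ::
  "('x::finite, 'u::finite, 'w::finite, 'q::finite, 'p::finite, 'e1::finite, 'e2::finite,
    'e3::finite, 'c1::finite, 'c2::finite, 'c3::finite) sdp_data
   \<Rightarrow> real^('e1 + 'e2 + 'e3 + 'p)^'x" where
  "E_stack P = (E_eta P ||| E_xi P ||| E_w P ||| E_o P)"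

definition C_stack ::
  "('x::finite, 'u::finite, 'w::finite, 'q::finite, 'p::finite, 'e1::finite, 'e2::finite,
    'e3::finite, 'c1::finite, 'c2::finite, 'c3::finite) sdp_data
   \<Rightarrow> real^'x^('c1 + 'c2 + 'c3 + 'q)" where
  "C_stack P = (C_eta P /// 0 /// 0 /// C_o P)"

definition D_stack ::
  "('x::finite, 'u::finite, 'w::finite, 'q::finite, 'p::finite, 'e1::finite, 'e2::finite,
    'e3::finite, 'c1::finite, 'c2::finite, 'c3::finite) sdp_data
   \<Rightarrow> real^'u^('c1 + 'c2 + 'c3 + 'q)" where
  "D_stack P = (0 /// D_xi P /// 0 /// D_o P)"

definition G_stack ::
  "('x::finite, 'u::finite, 'w::finite, 'q::finite, 'p::finite, 'e1::finite, 'e2::finite,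
    'e3::finite, 'c1::finite, 'c2::finite, 'c3::finite) sdp_data
   \<Rightarrow> real^'w^('c1 + 'c2 + 'c3 + 'q)" where
  "G_stack P = (0 /// 0 /// G_w P /// G_o P)"

definition N1_mat ::
  "('x::finite, 'u::finite, 'w::finite, 'q::finite, 'p::finite, 'e1::finite, 'e2::finite,
    'e3::finite, 'c1::finite, 'c2::finite, 'c3::finite) sdp_data
   \<Rightarrow> ('x, 'u, ('x, 'w, 'q, 'p, 'e1, 'e2, 'e3, 'c1, 'c2, 'c3) H_index) sdp_vars
   \<Rightarrow> nat \<Rightarrow> real^('c1 + 'c2 + 'c3 + 'q)^('c1 + 'c2 + 'c3 + 'q)" where
  "N1_mat P v j =
     block_diag (mat (lam_beta_eta v j))
    (block_diag (mat (lam_beta_xi v j))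
    (block_diag (mat (lam_beta_w v j))
                (mat (1 / real CARD('p) * lam_gam v j))))"

definition Gam_mat ::
  "('x::finite, 'u::finite, 'w::finite, 'q::finite, 'p::finite, 'e1::finite, 'e2::finite,
    'e3::finite, 'c1::finite, 'c2::finite, 'c3::finite) sdp_data \<Rightarrow> nat \<Rightarrow> real^'p^'p" where
  "Gam_mat P k = diag_mat (\<chi> i. SUP t\<in>seg P k. gam P t $ i)"

definition N2_mat ::
  "('x::finite, 'u::finite, 'w::finite, 'q::finite, 'p::finite, 'e1::finite, 'e2::finite,
    'e3::finite, 'c1::finite, 'c2::finite, 'c3::finite) sdp_data
   \<Rightarrow> ('x, 'u, ('x, 'w, 'q, 'p, 'e1, 'e2, 'e3, 'c1, 'c2, 'c3) H_index) sdp_vars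
   \<Rightarrow> nat \<Rightarrow> nat \<Rightarrow> real^('e1 + 'e2 + 'e3 + 'p)^('e1 + 'e2 + 'e3 + 'p)" where
  "N2_mat P v k j =
     block_diag (mat ((SUP t\<in>seg P k. beta_eta P t)\<^sup>2 * lam_beta_eta v j))
    (block_diag (mat ((SUP t\<in>seg P k. beta_xi P t)\<^sup>2 * lam_beta_xi v j))
    (block_diag (mat ((SUP t\<in>seg P k. beta_w P t)\<^sup>2 * lam_beta_w v j))
                (lam_gam v j *\<^sub>R (Gam_mat P k ** Gam_mat P k))))"

definition W_mat ::
  "('x::finite, 'u::finite, 'w::finite, 'q::finite, 'p::finite, 'e1::finite, 'e2::finite,
    'e3::finite, 'c1::finite, 'c2::finite, 'c3::finite) sdp_data
   \<Rightarrow> ('x, 'u, ('x, 'w, 'q, 'p, 'e1, 'e2, 'e3, 'c1, 'c2, 'c3) H_index) sdp_vars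
   \<Rightarrow> nat \<Rightarrow> nat \<Rightarrow> real^'x^'x" where
  "W_mat P v i j =
     A_jac P (node P i) ** Q_var v j + B_jac P (node P i) ** Y_var v j
     + Q_var v j ** transpose (A_jac P (node P i))
     + transpose (Y_var v j) ** transpose (B_jac P (node P i))
     + lam_w P *\<^sub>R Q_var v j"

definition H_mat ::
  "('x::finite, 'u::finite, 'w::finite, 'q::finite, 'p::finite, 'e1::finite, 'e2::finite,
    'e3::finite, 'c1::finite, 'c2::finite, 'c3::finite) sdp_data
   \<Rightarrow> ('x, 'u, ('x, 'w, 'q, 'p, 'e1, 'e2, 'e3, 'c1, 'c2, 'c3) H_index) sdp_vars
   \<Rightarrow> nat \<Rightarrow> nat \<Rightarrow> nat
   \<Rightarrow> real^(('x, 'w, 'q, 'p, 'e1, 'e2, 'e3, 'c1, 'c2, 'c3) H_index)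
         ^(('x, 'w, 'q, 'p, 'e1, 'e2, 'e3, 'c1, 'c2, 'c3) H_index)" where
  "H_mat P v k i j =
    (let Qdot = (1 / (node P (Suc k) - node P k)) *\<^sub>R (Q_var v (Suc k) - Q_var v k);
         F = F_jac P (node P j);
         N1 = N1_mat P v j;
         N2 = N2_mat P v k j;
         NE = N2 ** transpose (E_stack P);
         S = C_stack P ** Q_var v j + D_stack P ** Y_var v j;
         G = G_stack P
     in - ((W_mat P v i j - Qdot ||| transpose NE ||| F               ||| transpose S) ///
           (NE                   ||| - N2         ||| 0               ||| 0) ///
           (transpose F          ||| 0            ||| - mat (lam_w P) ||| transpose G) ///
           (S                    ||| 0            ||| G               ||| - N1)))"

definition lmi_a ::
  "('x::finite, 'u::finite, 'w::finite, 'q::finite, 'p::finite, 'e1::finite, 'e2::finite,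
    'e3::finite, 'c1::finite, 'c2::finite, 'c3::finite) sdp_data
   \<Rightarrow> ('x, 'u, ('x, 'w, 'q, 'p, 'e1, 'e2, 'e3, 'c1, 'c2, 'c3) H_index) sdp_vars
   \<Rightarrow> nat \<Rightarrow> bool" where
  "lmi_a P v k \<longleftrightarrow>
     psd (H_mat P v k k k) \<and> psd (H_mat P v k (Suc k) (Suc k)) \<and>
     psd (H_mat P v k k (Suc k) + H_mat P v k (Suc k) k)"

definition lmi_b ::
  "('x::finite, 'u::finite, 'w::finite, 'q::finite, 'p::finite, 'e1::finite, 'e2::finite,
    'e3::finite, 'c1::finite, 'c2::finite, 'c3::finite) sdp_data
   \<Rightarrow> ('x, 'u, ('x, 'w, 'q, 'p, 'e1, 'e2, 'e3, 'c1, 'c2, 'c3) H_index) sdp_vars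
   \<Rightarrow> nat \<Rightarrow> bool" where
  "lmi_b P v k \<longleftrightarrow>
     (\<forall>i\<in>{k, Suc k}. \<forall>j\<in>{k, Suc k}.
        X_var v k i j = transpose (X_var v k j i) \<and> psd (X_var v k i j)) \<and>
     (let M = (1 / 2) *\<^sub>R (H_mat P v k k (Suc k) + H_mat P v k (Suc k) k) - X_var v k (Suc k) k
      in psd ((H_mat P v k k k - X_var v k k k ||| transpose M) ///
              (M ||| H_mat P v k (Suc k) (Suc k) - X_var v k (Suc k) (Suc k))))"

definition sdp_feasible ::
  "('x::finite, 'u::finite, 'w::finite, 'q::finite, 'p::finite, 'e1::finite, 'e2::finite,
    'e3::finite, 'c1::finite, 'c2::finite, 'c3::finite) sdp_data
   \<Rightarrow> ('x, 'u, ('x, 'w, 'q, 'p, 'e1, 'e2, 'e3, 'c1, 'c2, 'c3) H_index) sdp_vars \<Rightarrow> bool" where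
  "sdp_feasible P v \<longleftrightarrow>
     (\<forall>k\<le>num_int P. transpose (Q_var v k) = Q_var v k) \<and>
     (\<forall>k\<le>num_int P. 0 < lam_beta_eta v k \<and> 0 < lam_beta_xi v k \<and> 0 < lam_beta_w v k \<and> 0 < lam_gam v k) \<and>
     (\<forall>k<num_int P. lmi_a P v k \<or> lmi_b P v k) \<and>
     (\<forall>k\<le>num_int P. \<forall>i\<in>{1..num_h P}.
        psd ((mat ((b_h P i - a_h P i \<bullet> xbar P (node P k))\<^sup>2) ||| rowvector (a_h P i v* Q_var v k)) ///
             (columnvector (Q_var v k *v a_h P i) ||| Q_var v k) :: real^(1 + 'x)^(1 + 'x))) \<and>
     (\<forall>k\<le>num_int P. \<forall>j\<in>{1..num_g P}.
        psd ((mat ((b_g P j - a_g P j \<bullet> ubar P (node P k))\<^sup>2) ||| rowvector (a_g P j v* Y_var v k)) ///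
             (columnvector (transpose (Y_var v k) *v a_g P j) ||| Q_var v k) :: real^(1 + 'x)^(1 + 'x))) \<and>
     (\<forall>k\<le>num_int P. pd (Q_var v k) \<and> psd (Q_max P - Q_var v k))"

definition sdp_cost ::
  "('x::finite, 'u::finite, 'w::finite, 'q::finite, 'p::finite, 'e1::finite, 'e2::finite,
    'e3::finite, 'c1::finite, 'c2::finite, 'c3::finite) sdp_data
   \<Rightarrow> (nat \<Rightarrow> real^'x^'x) \<Rightarrow> real" where
  "sdp_cost P Qs = cost P (map Qs [0..<Suc (num_int P)])"

text \<open>
  Convexity is only demanded on tuples of positive definite matrices, so that real-valued costs such
  as \<open>- log det\<close> are covered.
\<close>

definition convex_cost ::
  "('x::finite, 'u::finite, 'w::finite, 'q::finite, 'p::finite, 'e1::finite, 'e2::finite,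
    'e3::finite, 'c1::finite, 'c2::finite, 'c3::finite) sdp_data \<Rightarrow> bool" where
  "convex_cost P \<longleftrightarrow>
     (\<forall>Qs Qs'. \<forall>s\<in>{0..1}. (\<forall>k\<le>num_int P. pd (Qs k) \<and> pd (Qs' k)) \<longrightarrow>
        sdp_cost P (\<lambda>k. (1 - s) *\<^sub>R Qs k + s *\<^sub>R Qs' k) \<le> (1 - s) * sdp_cost P Qs + s * sdp_cost P Qs')"

definition sdp_solution ::
  "('x::finite, 'u::finite, 'w::finite, 'q::finite, 'p::finite, 'e1::finite, 'e2::finite,
    'e3::finite, 'c1::finite, 'c2::finite, 'c3::finite) sdp_data
   \<Rightarrow> ('x, 'u, ('x, 'w, 'q, 'p, 'e1, 'e2, 'e3, 'c1, 'c2, 'c3) H_index) sdp_vars \<Rightarrow> bool" where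
  "sdp_solution P v \<longleftrightarrow> sdp_feasible P v \<and>
     (\<forall>v'. sdp_feasible P v' \<longrightarrow> sdp_cost P (Q_var v) \<le> sdp_cost P (Q_var v'))"


section \<open>Funnels and closed-loop trajectories\<close>

definition state_ellipsoid :: "real^'x^'x \<Rightarrow> (real^'x) set" where
  "state_ellipsoid Q = {\<eta>. \<eta> \<bullet> (matrix_inv Q *v \<eta>) \<le> 1}"

definition input_ellipsoid :: "real^'x^'u \<Rightarrow> real^'x^'x \<Rightarrow> (real^'u) set" where
  "input_ellipsoid K Q = {mat_sqrt (K ** Q ** transpose K) *v y | y. norm y \<le> 1}"

text \<open>The sums below are Minkowski sums.\<close>

definition funnel ::
  "('x::finite, 'u::finite, 'w::finite, 'q::finite, 'p::finite, 'e1::finite, 'e2::finite,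
    'e3::finite, 'c1::finite, 'c2::finite, 'c3::finite) sdp_data
   \<Rightarrow> (real \<Rightarrow> real^'x^'x) \<Rightarrow> (real \<Rightarrow> real^'x^'u) \<Rightarrow> real \<Rightarrow> ((real^'x) \<times> (real^'u)) set" where
  "funnel P Q K t = ({xbar P t} + state_ellipsoid (Q t)) \<times> ({ubar P t} + input_ellipsoid (K t) (Q t))"

definition feedback ::
  "('x::finite, 'u::finite, 'w::finite, 'q::finite, 'p::finite, 'e1::finite, 'e2::finite,
    'e3::finite, 'c1::finite, 'c2::finite, 'c3::finite) sdp_data
   \<Rightarrow> (real \<Rightarrow> real^'x^'u) \<Rightarrow> (real \<Rightarrow> real^'x) \<Rightarrow> real \<Rightarrow> real^'u" where
  "feedback P K x t = ubar P t + K t *v (x t - xbar P t)"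

definition closed_loop ::
  "('x::finite, 'u::finite, 'w::finite, 'q::finite, 'p::finite, 'e1::finite, 'e2::finite,
    'e3::finite, 'c1::finite, 'c2::finite, 'c3::finite) sdp_data
   \<Rightarrow> (real \<Rightarrow> real^'x \<Rightarrow> real^'u \<Rightarrow> real^'w \<Rightarrow> real^'x)
   \<Rightarrow> (real \<Rightarrow> real^'x^'x) \<Rightarrow> (real \<Rightarrow> real^'x^'u)
   \<Rightarrow> (real \<Rightarrow> real^'w) \<Rightarrow> (real \<Rightarrow> real^'x) \<Rightarrow> bool" where
  "closed_loop P f Q K w x \<longleftrightarrow>
     admissible (t_init P) (t_final P) w \<and>
     solves_on f (t_init P) (t_final P) x (feedback P K x) w \<and>
     x (t_init P) \<in> {xbar P (t_init P)} + state_ellipsoid (Q (t_init P))"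

definition q_out ::
  "('x::finite, 'u::finite, 'w::finite, 'q::finite, 'p::finite, 'e1::finite, 'e2::finite,
    'e3::finite, 'c1::finite, 'c2::finite, 'c3::finite) sdp_data
   \<Rightarrow> real^'x \<Rightarrow> real^'u \<Rightarrow> real^'w \<Rightarrow> real^'q" where
  "q_out P x u w = C_o P *v x + D_o P *v u + G_o P *v w"

text \<open>
  The set \<open>Q\<^sub>s\<close> on which the Lipschitz bounds hold. The values of \<open>q\<close> along closed-loop trajectories are
  taken for almost every time: an admissible disturbance is arbitrary at its jumps, so no compact
  set could contain the values of \<open>q\<close> there for all disturbances.
\<close>

definition contains_outputs ::
  "('x::finite, 'u::finite, 'w::finite, 'q::finite, 'p::finite, 'e1::finite, 'e2::finite,
    'e3::finite, 'c1::finite, 'c2::finite, 'c3::finite) sdp_data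
   \<Rightarrow> (real \<Rightarrow> real^'x \<Rightarrow> real^'u \<Rightarrow> real^'w \<Rightarrow> real^'x)
   \<Rightarrow> (real \<Rightarrow> real^'x^'x) \<Rightarrow> (real \<Rightarrow> real^'x^'u) \<Rightarrow> (real^'q) set \<Rightarrow> bool" where
  "contains_outputs P f Q K Qs \<longleftrightarrow>
     (\<forall>t\<in>horizon P. q_out P (xbar P t) (ubar P t) 0 \<in> Qs) \<and>
     (\<forall>w x. closed_loop P f Q K w x \<longrightarrow>
        (AE t in lebesgue_on (horizon P). q_out P (x t) (feedback P K x t) (w t) \<in> Qs))"

end

theory Submission
  imports Defs
begin

text \<open>
  The candidate Lyapunov function is \<open>V(t) = \<eta> \<bullet> Q(t)\<^sup>-\<^sup>1 \<eta>\<close> for the deviation \<open>\<eta> = x - xbar\<close>. The claim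
  \<open>V \<le> 1\<close> follows from \<open>V' \<le> \<lambda>\<^sub>w (\<bar>w\<bar>\<^sup>2 - V)\<close>, because \<open>\<bar>w\<bar> \<le> 1\<close> for almost every time.

  To get this differential inequality, put \<open>y = Q(t)\<^sup>-\<^sup>1 \<eta>\<close>. On one interval \<open>Q\<close> is affine with derivative
  \<open>Qdot\<close>, and \<open>V' = 2 y \<bullet> \<eta>' - y \<bullet> Qdot y\<close> (from \<open>affine_inverse_has_vector_derivative\<close>). Writing the
  Jacobians as interpolant plus error, the deviation satisfies
  \<open>\<eta>' = A Q y + B Y y + F w + E\<^sub>\<eta> p\<^sub>1 + E\<^sub>\<xi> p\<^sub>2 + E\<^sub>w p\<^sub>3 + E\<^sub>o p\<^sub>4\<close> with interpolated \<open>A\<close>, \<open>B\<close>, \<open>F\<close>, where each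
  channel \<open>p\<^sub>i\<close> is bounded by a known gain times a known linear output: through the norm of a \<open>\<Delta>\<close> for
  \<open>p\<^sub>1, p\<^sub>2, p\<^sub>3\<close>, and through the Lipschitz constants of \<open>\<phi>\<close> for \<open>p\<^sub>4\<close>.

  The blocks of \<open>H\<^sup>k\<^sub>i\<^sub>j\<close> are built so that, after interpolation, the quadratic form is
  \<open>\<lambda>\<^sub>w (\<bar>w\<bar>\<^sup>2 - V) - V'\<close> with each channel replaced by a multiplier term (\<open>H_quadratic_form\<close>).
  It is affine in \<open>A\<^sub>i\<close>, \<open>B\<^sub>i\<close> and affine in the data with index \<open>j\<close>, so the interpolated form is the combination of the four \<open>H\<^sup>k\<^sub>i\<^sub>j\<close> with weights \<open>\<sigma>\<^sub>i \<sigma>\<^sub>j\<close>, and either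
  kind of matrix inequality makes that combination nonnegative (\<open>H_interpolated_nonneg\<close>). Evaluating it
  at the channel values divided by the corresponding blocks of \<open>N\<^sub>2\<close> makes the channels reappear, and
  evaluating it at the outputs divided by those of \<open>N\<^sub>1\<close> takes the Schur complement of the last block. What
  remains of a multiplier term compares a channel with its output and has the sign given by the channel
  bound, which leaves \<open>dissipation_inequality\<close>.

  A nonpositive derivative at almost every time gives monotonicity because \<open>V\<close> is differentiable outside
  a finite set and therefore is the Henstock-Kurzweil integral of its derivative; the exceptional null
  set does not contribute to the integral (\<open>sublevel_invariance\<close>). The bound is carried from node to node
  by induction.

  For the input, \<open>V \<le> 1\<close> and the Cauchy-Schwarz inequality of the form \<open>Q\<close> give
  \<open>u \<bullet> K \<eta> \<le> \<bar>(K Q K\<^sup>T)\<^sup>1\<^sup>/\<^sup>2 u\<bar>\<close> for every \<open>u\<close>, which says that no hyperplane separates \<open>K \<eta>\<close> from the image of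
  the unit ball under \<open>(K Q K\<^sup>T)\<^sup>1\<^sup>/\<^sup>2\<close>. The spectral theorem is needed only to know that this square root
  exists and is unique.
\<close>

section \<open>Matrices and quadratic forms\<close>

lemma matrix_vector_mult_uminus_right: "(M :: real^'n^'m) *v (- x) = - (M *v x)"
  by (simp add: linear_neg)

lemma matrix_vector_mult_uminus_left: "(- M :: real^'n^'m) *v x = - (M *v x)"
  by (simp add: vec_eq_iff matrix_vector_mult_def sum_negf)

lemma inner_matrix_vector_symmetric:
  fixes M :: "real^'n^'n"
  assumes "transpose M = M"
  shows "x \<bullet> (M *v y) = (M *v x) \<bullet> y"
  by (metis assms dot_lmul_matrix transpose_matrix_vector)

lemma matrix_eq_on_spanning_set:
  fixes M N :: "real^'n^'m"
  assumes "span B = UNIV" "\<And>b. b \<in> B \<Longrightarrow> M *v b = N *v b"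
  shows "M = N"
proof -
  have "M *v x = N *v x" for x
    using linear_eq_on_span[of "(*v) M" "(*v) N" B x] assms by simp
  then show ?thesis by (simp add: matrix_eq)
qed

lemma norm_mult_le_of_onorm_le:
  fixes M :: "real^'n^'m"
  assumes "onorm ((*v) M) \<le> b" "b \<le> b'"
  shows "norm (M *v z) \<le> b' * norm z"
proof -
  have "norm (M *v z) \<le> onorm ((*v) M) * norm z"
    by (rule onorm) (rule matrix_vector_mul_bounded_linear)
  also have "\<dots> \<le> b' * norm z" using assms by (intro mult_right_mono) auto
  finally show ?thesis .
qed

section \<open>Square roots of positive semidefinite matrices\<close>

text \<open>
  A maximizer of the Rayleigh quotient on the unit sphere of \<open>S\<close> is an eigenvector: its residual
  \<open>h = M e - \<mu> e\<close> lies in \<open>S\<close>, so it is an allowed direction of variation, and the quotient would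
  grow along it unless \<open>h = 0\<close>.
\<close>

lemma symmetric_matrix_eigenvector_in_subspace:
  fixes M :: "real^'n^'n"
  assumes sym: "transpose M = M" and S: "subspace S" and u: "u \<in> S" "u \<noteq> 0"
    and inv: "\<And>x. x \<in> S \<Longrightarrow> M *v x \<in> S"
  obtains e \<mu> where "e \<in> S" "norm e = 1" "M *v e = \<mu> *\<^sub>R e"
proof -
  have "compact (S \<inter> sphere 0 1)"
    using closed_subspace[OF S] by (simp add: closed_Int_compact)
  moreover have "S \<inter> sphere 0 1 \<noteq> {}"
  proof -
    have "(1 / norm u) *\<^sub>R u \<in> S \<inter> sphere 0 1"
      using u S by (simp add: subspace_scale)
    then show ?thesis by blast
  qed
  moreover have "continuous_on (S \<inter> sphere 0 1) (\<lambda>x. x \<bullet> (M *v x))"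
    by (intro continuous_intros linear_continuous_on matrix_vector_mul_bounded_linear)
  ultimately obtain e where "e \<in> S \<inter> sphere 0 1"
    and "\<forall>x \<in> S \<inter> sphere 0 1. x \<bullet> (M *v x) \<le> e \<bullet> (M *v e)"
    using continuous_attains_sup[of "S \<inter> sphere 0 1" "\<lambda>x. x \<bullet> (M *v x)"] by meson
  then have e: "e \<in> S" "norm e = 1"
    and max: "\<And>x. x \<in> S \<Longrightarrow> norm x = 1 \<Longrightarrow> x \<bullet> (M *v x) \<le> e \<bullet> (M *v e)"
    by auto
  define \<mu> where "\<mu> = e \<bullet> (M *v e)"
  have le: "x \<bullet> (M *v x) \<le> \<mu> * (x \<bullet> x)" if "x \<in> S" for x
  proof (cases "x = 0")
    case False
    have "(1 / norm x) *\<^sub>R x \<in> S"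
      using that S by (simp add: subspace_scale)
    from max[OF this] False have "(x \<bullet> (M *v x)) / (norm x)\<^sup>2 \<le> \<mu>"
      by (simp add: \<mu>_def matrix_vector_mult_scaleR power2_eq_square)
    then show ?thesis
      using False by (simp add: divide_le_eq power2_norm_eq_inner)
  qed simp
  define h where "h = M *v e - \<mu> *\<^sub>R e"
  define c where "c = \<mu> * (h \<bullet> h) - h \<bullet> (M *v h)"
  have hS: "h \<in> S"
    unfolding h_def using e inv S by (simp add: subspace_diff subspace_scale)
  have he: "h \<bullet> (M *v e) - \<mu> * (h \<bullet> e) = h \<bullet> h"
    by (simp add: h_def inner_diff_right inner_diff_left)
  have ee: "e \<bullet> e = 1"
    using e by (simp add: dot_square_norm)
  have eh: "e \<bullet> (M *v h) = h \<bullet> (M *v e)"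
    using inner_matrix_vector_symmetric[OF sym, of e h] by (simp add: inner_commute)
  \<comment> \<open>First variation of the Rayleigh quotient at its maximum, in the direction \<open>h\<close>.\<close>
  have var: "2 * r * (h \<bullet> h) \<le> r\<^sup>2 * c" for r
  proof -
    have "e + r *\<^sub>R h \<in> S"
      using e hS S by (simp add: subspace_add subspace_scale)
    from le[OF this] have "\<mu> + 2 * r * (h \<bullet> (M *v e)) + r\<^sup>2 * (h \<bullet> (M *v h))
        \<le> \<mu> * (1 + 2 * r * (h \<bullet> e) + r\<^sup>2 * (h \<bullet> h))"
      by (simp add: matrix_vector_right_distrib matrix_vector_mult_scaleR inner_add_left
          inner_add_right eh ee \<mu>_def[symmetric] power2_eq_square inner_commute[of e h] algebra_simps)
    then show ?thesis
      unfolding c_def using arg_cong[OF he, of "\<lambda>d. 2 * r * d"] by (simp add: algebra_simps)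
  qed
  have "c \<ge> 0"
    using le[OF hS] by (simp add: c_def)
  have "h = 0"
  proof (rule ccontr)
    assume "h \<noteq> 0"
    then have pos: "h \<bullet> h > 0" by simp
    define r where "r = (h \<bullet> h) / (c + 1)"
    have r: "r > 0" using pos \<open>c \<ge> 0\<close> by (simp add: r_def)
    have "r * (2 * (h \<bullet> h)) \<le> r * (r * c)"
      using var[of r] by (simp add: power2_eq_square mult_ac)
    then have "2 * (h \<bullet> h) \<le> r * c" using r by simp
    also have "r * c \<le> r * (c + 1)" using r by simp
    also have "r * (c + 1) = h \<bullet> h" using \<open>c \<ge> 0\<close> by (simp add: r_def)
    finally show False using pos by simp
  qed
  then show ?thesis using that[of e \<mu>] e by (simp add: h_def)
qed

text \<open>
  An orthonormal set of eigenvectors of largest size spans: its orthogonal complement is invariant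
  under \<open>M\<close>, so if it were nontrivial it would contribute one more eigenvector.
\<close>

lemma symmetric_matrix_eigenbasis:
  fixes M :: "real^'n^'n"
  assumes sym: "transpose M = M"
  obtains B l where "finite B" "pairwise orthogonal B" "\<And>b. b \<in> B \<Longrightarrow> norm b = 1"
    "\<And>b. b \<in> B \<Longrightarrow> M *v b = l b *\<^sub>R b" "span B = UNIV"
proof -
  define ok where "ok B \<longleftrightarrow> finite B \<and> pairwise orthogonal B \<and>
    (\<forall>b\<in>B. norm b = 1 \<and> (\<exists>\<mu>. M *v b = \<mu> *\<^sub>R b))" for B
  have bound: "card B \<le> DIM(real^'n)" if "ok B" for B
  proof -
    have "0 \<notin> B" using that by (auto simp: ok_def)
    then show ?thesis
      using that pairwise_orthogonal_independent independent_bound unfolding ok_def by blast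
  qed
  have "ok {}" by (simp add: ok_def)
  moreover have "\<forall>B. ok B \<longrightarrow> card B < DIM(real^'n) + 1"
    using bound by fastforce
  ultimately obtain B where B: "ok B" and max: "\<And>B'. ok B' \<Longrightarrow> card B' \<le> card B"
    using ex_has_greatest_nat[of ok "{}" card "DIM(real^'n) + 1"] by blast
  have "span B = UNIV"
  proof (rule ccontr)
    assume "span B \<noteq> UNIV"
    then obtain a where a: "a \<noteq> 0" "\<And>x. x \<in> span B \<Longrightarrow> a \<bullet> x = 0"
      using span_not_UNIV_orthogonal by metis
    define S where "S = {x. \<forall>b\<in>B. b \<bullet> x = 0}"
    have S: "subspace S"
      by (auto simp: S_def subspace_def inner_add_right)
    have aS: "a \<in> S"
      using a by (auto simp: S_def span_base inner_commute)
    have inv: "M *v x \<in> S" if "x \<in> S" for x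
      unfolding S_def
    proof (clarify)
      fix b assume b: "b \<in> B"
      then obtain \<mu> where "M *v b = \<mu> *\<^sub>R b" using B by (auto simp: ok_def)
      then show "b \<bullet> (M *v x) = 0"
        using that b by (simp add: inner_matrix_vector_symmetric[OF sym] S_def)
    qed
    obtain e \<mu> where e: "e \<in> S" "norm e = 1" "M *v e = \<mu> *\<^sub>R e"
      using symmetric_matrix_eigenvector_in_subspace[OF sym S aS a(1) inv] by blast
    have "e \<notin> B" using e by (auto simp: S_def)
    have "ok (insert e B)"
      using B e by (auto simp: ok_def pairwise_insert orthogonal_def S_def inner_commute)
    from max[OF this] show False
      using \<open>e \<notin> B\<close> B by (simp add: ok_def)
  qed
  moreover obtain l where "\<And>b. b \<in> B \<Longrightarrow> M *v b = l b *\<^sub>R b"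
    using B unfolding ok_def by metis
  ultimately show ?thesis using that[of B l] B by (auto simp: ok_def)
qed

text \<open>
  This is what makes the square root unique. The vector \<open>z = R b - \<surd>l b\<close> satisfies \<open>R z = - \<surd>l z\<close>,
  which for \<open>l > 0\<close> is compatible with \<open>R\<close> being positive semidefinite only if \<open>z = 0\<close>. For \<open>l = 0\<close>,
  the vector \<open>R b\<close> vanishes since its squared norm is \<open>b \<bullet> R R b\<close>.
\<close>

lemma psd_sqrt_eigenvector:
  fixes R :: "real^'n^'n"
  assumes R: "psd R" and b: "(R ** R) *v b = l *\<^sub>R b" and l: "l \<ge> 0"
  shows "R *v b = sqrt l *\<^sub>R b"
proof -
  define z where "z = R *v b - sqrt l *\<^sub>R b"
  have RRb: "R *v (R *v b) = l *\<^sub>R b"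
    using b by (simp add: matrix_vector_mul_assoc)
  have "R *v z = - (sqrt l *\<^sub>R z)"
    using l by (simp add: z_def matrix_vector_mult_diff_distrib matrix_vector_mult_scaleR RRb
        scaleR_diff_right)
  then have ge: "0 \<le> - (sqrt l * (z \<bullet> z))"
    using R by (auto simp: psd_def dest!: spec[of _ z])
  have "z = 0"
  proof (cases "l = 0")
    case True
    have "(R *v b) \<bullet> (R *v b) = b \<bullet> (R *v (R *v b))"
      using R inner_matrix_vector_symmetric[of R b "R *v b"] by (simp add: psd_def)
    then show ?thesis using True RRb by (simp add: z_def)
  next
    case False
    then have "z \<bullet> z \<le> 0"
      using ge l by (simp add: mult_le_0_iff)
    then have "z \<bullet> z = 0"
      using inner_ge_zero[of z] by linarith
    then show ?thesis by simp
  qed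
  then show ?thesis by (simp add: z_def)
qed

lemma psd_square_root_unique_existence:
  fixes M :: "real^'n^'n"
  assumes M: "psd M"
  shows "\<exists>!R. psd R \<and> R ** R = M"
proof -
  have sym: "transpose M = M" using M by (simp add: psd_def)
  obtain B l where B: "finite B" "pairwise orthogonal B" "\<And>b. b \<in> B \<Longrightarrow> norm b = 1"
    "\<And>b. b \<in> B \<Longrightarrow> M *v b = l b *\<^sub>R b" "span B = UNIV"
    using symmetric_matrix_eigenbasis[OF sym] by metis
  have bb: "b \<bullet> b = 1" if "b \<in> B" for b
    using B(3)[OF that] by (simp add: dot_square_norm)
  have l: "l b \<ge> 0" if "b \<in> B" for b
  proof -
    have "0 \<le> b \<bullet> (M *v b)" using M by (simp add: psd_def)
    then show ?thesis using B(4)[OF that] bb[OF that] by simp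
  qed
  \<comment> \<open>The map that multiplies each eigenvector by the square root of its eigenvalue.\<close>
  define r where "r x = (\<Sum>b\<in>B. (sqrt (l b) * (b \<bullet> x)) *\<^sub>R b)" for x :: "real^'n"
  have lin: "linear r"
    by (rule linearI) (simp_all add: r_def inner_add_right distrib_left scaleR_add_left
        sum.distrib scaleR_sum_right mult_ac)
  define R where "R = matrix r"
  have R: "R *v x = r x" for x
    by (simp add: R_def matrix_works[OF lin[unfolded linear_matrix_vector_mul_eq[symmetric]]])
  have Rb: "R *v b = sqrt (l b) *\<^sub>R b" if b: "b \<in> B" for b
  proof -
    have "(sqrt (l c) * (c \<bullet> b)) *\<^sub>R c = (if c = b then sqrt (l b) *\<^sub>R b else 0)" if "c \<in> B" for c
      using that b B(2) bb[OF b] by (auto simp: pairwise_def orthogonal_def)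
    then show ?thesis
      using B(1) b by (simp add: R r_def sum.delta cong: sum.cong)
  qed
  have RR: "R ** R = M"
    by (rule matrix_eq_on_spanning_set[OF B(5)])
      (simp add: matrix_vector_mul_assoc[symmetric] Rb B(4) matrix_vector_mult_scaleR l)
  have inner: "x \<bullet> (R *v y) = (\<Sum>b\<in>B. sqrt (l b) * (b \<bullet> x) * (b \<bullet> y))" for x y
    by (simp add: R r_def inner_sum_right inner_commute mult_ac)
  have "x \<bullet> (transpose R *v y) = x \<bullet> (R *v y)" for x y
  proof -
    have "x \<bullet> (transpose R *v y) = y \<bullet> (R *v x)"
      by (simp add: dot_lmul_matrix inner_commute[of x])
    then show ?thesis by (simp add: inner mult_ac)
  qed
  then have "transpose R *v y = R *v y" for y
    by (meson vector_eq_ldot)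
  then have "transpose R = R"
    by (simp add: matrix_eq del: transpose_matrix_vector)
  moreover have "0 \<le> x \<bullet> (R *v x)" for x
    unfolding inner by (intro sum_nonneg) (simp add: l mult.assoc)
  ultimately have "psd R" by (simp add: psd_def)
  moreover have "R' = R" if R': "psd R'" "R' ** R' = M" for R'
    by (rule matrix_eq_on_spanning_set[OF B(5)])
      (simp add: Rb psd_sqrt_eigenvector[OF R'(1)] R'(2) B(4) l)
  ultimately show ?thesis using RR by blast
qed

lemma mat_sqrt_psd:
  assumes "psd M"
  shows "psd (mat_sqrt M)" "mat_sqrt M ** mat_sqrt M = M"
  using theI'[OF psd_square_root_unique_existence[OF assms]] by (simp_all add: mat_sqrt_def)

section \<open>Positive definite matrices\<close>

lemma pd_coercive:
  fixes M :: "real^'n^'n"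
  assumes "pd M"
  obtains c where "c > 0" "\<And>z. c * (norm z)\<^sup>2 \<le> z \<bullet> (M *v z)"
proof -
  have "continuous_on (sphere 0 1) (\<lambda>x. x \<bullet> (M *v x))"
    by (intro continuous_intros linear_continuous_on matrix_vector_mul_bounded_linear)
  moreover have "sphere (0::real^'n) 1 \<noteq> {}" by simp
  ultimately obtain e where "e \<in> sphere 0 1"
    and "\<forall>x \<in> sphere 0 1. e \<bullet> (M *v e) \<le> x \<bullet> (M *v x)"
    using continuous_attains_inf[OF compact_sphere, of 0 1 "\<lambda>x. x \<bullet> (M *v x)"] by meson
  then have e: "norm e = 1"
    and min: "\<And>x. norm x = 1 \<Longrightarrow> e \<bullet> (M *v e) \<le> x \<bullet> (M *v x)"
    by auto
  show ?thesis
  proof (rule that[of "e \<bullet> (M *v e)"])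
    have "e \<noteq> 0" using e by auto
    then show "e \<bullet> (M *v e) > 0" using assms by (auto simp: pd_def)
    fix z
    show "e \<bullet> (M *v e) * (norm z)\<^sup>2 \<le> z \<bullet> (M *v z)"
    proof (cases "z = 0")
      case False
      have "norm ((1 / norm z) *\<^sub>R z) = 1" using False by simp
      from min[OF this] False have "e \<bullet> (M *v e) \<le> (z \<bullet> (M *v z)) / (norm z)\<^sup>2"
        by (simp add: matrix_vector_mult_scaleR power2_eq_square)
      then show ?thesis using False by (simp add: le_divide_eq)
    qed simp
  qed
qed

text \<open>
  The constant is uniform in the weights, which bounds \<open>Q(t)\<^sup>-\<^sup>1\<close> uniformly on a time interval.
\<close>

lemma pd_coercive_convex_combination:
  fixes M N :: "real^'n^'n"
  assumes "pd M" "pd N"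
  obtains c where "c > 0" "\<And>\<sigma> \<tau> z. 0 \<le> \<sigma> \<Longrightarrow> 0 \<le> \<tau> \<Longrightarrow> \<sigma> + \<tau> = 1 \<Longrightarrow>
    c * (norm z)\<^sup>2 \<le> z \<bullet> ((\<sigma> *\<^sub>R M + \<tau> *\<^sub>R N) *v z)"
proof -
  obtain a where a: "a > 0" "\<And>z. a * (norm z)\<^sup>2 \<le> z \<bullet> (M *v z)"
    using pd_coercive[OF assms(1)] by blast
  obtain b where b: "b > 0" "\<And>z. b * (norm z)\<^sup>2 \<le> z \<bullet> (N *v z)"
    using pd_coercive[OF assms(2)] by blast
  show ?thesis
  proof (rule that[of "min a b"])
    show "min a b > 0" using a b by simp
    fix \<sigma> \<tau> :: real and z :: "real^'n"
    assume st: "0 \<le> \<sigma>" "0 \<le> \<tau>" "\<sigma> + \<tau> = 1"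
    let ?n = "min a b * (norm z)\<^sup>2"
    have "?n \<le> a * (norm z)\<^sup>2" "?n \<le> b * (norm z)\<^sup>2"
      by (intro mult_right_mono; simp)+
    then have "?n \<le> z \<bullet> (M *v z)" "?n \<le> z \<bullet> (N *v z)"
      using a(2)[of z] b(2)[of z] by linarith+
    then have "\<sigma> * ?n + \<tau> * ?n \<le> \<sigma> * (z \<bullet> (M *v z)) + \<tau> * (z \<bullet> (N *v z))"
      using st by (intro add_mono mult_left_mono)
    moreover have "\<sigma> * ?n + \<tau> * ?n = ?n"
      using st(3) by (metis distrib_right mult_1)
    ultimately show "?n \<le> z \<bullet> ((\<sigma> *\<^sub>R M + \<tau> *\<^sub>R N) *v z)"
      by (simp add: matrix_vector_mult_add_rdistrib scaleR_matrix_vector_assoc[symmetric]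
          inner_add_right)
  qed
qed

lemma pd_convex_combination:
  fixes M N :: "real^'n^'n"
  assumes "pd M" "pd N" "0 \<le> \<sigma>" "0 \<le> \<tau>" "\<sigma> + \<tau> = 1"
  shows "pd (\<sigma> *\<^sub>R M + \<tau> *\<^sub>R N)"
proof -
  obtain c where c: "c > 0" "\<And>z. c * (norm z)\<^sup>2 \<le> z \<bullet> ((\<sigma> *\<^sub>R M + \<tau> *\<^sub>R N) *v z)"
    using pd_coercive_convex_combination[OF assms(1,2)] assms(3-) by metis
  have "0 < z \<bullet> ((\<sigma> *\<^sub>R M + \<tau> *\<^sub>R N) *v z)" if "z \<noteq> 0" for z
    by (rule less_le_trans[OF _ c(2)]) (use that c(1) in simp)
  moreover have "transpose (\<sigma> *\<^sub>R M + \<tau> *\<^sub>R N) = \<sigma> *\<^sub>R M + \<tau> *\<^sub>R N"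
    using assms(1,2) by (simp add: pd_def transpose_def vec_eq_iff)
  ultimately show ?thesis by (simp add: pd_def)
qed

lemma coercive_matrix_inverse:
  fixes M :: "real^'n^'n"
  assumes c: "c > 0" and le: "\<And>z. c * (norm z)\<^sup>2 \<le> z \<bullet> (M *v z)"
  shows "M *v (matrix_inv M *v r) = r" "matrix_inv M *v (M *v r) = r"
    "norm (matrix_inv M *v r) \<le> norm r / c"
proof -
  have "M *v x = M *v y \<Longrightarrow> x = y" for x y
  proof -
    assume "M *v x = M *v y"
    then have "M *v (x - y) = 0" by (simp add: matrix_vector_mult_diff_distrib)
    with le[of "x - y"] have "c * (norm (x - y))\<^sup>2 \<le> 0" by simp
    then show "x = y" using c by (simp add: mult_le_0_iff)
  qed
  then have "inj ((*v) M)" by (rule injI)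
  then have "invertible M"
    by (metis invertible_left_inverse matrix_left_invertible_injective)
  then have MM: "M ** matrix_inv M = mat 1" "matrix_inv M ** M = mat 1"
    unfolding invertible_def matrix_inv_def by (metis (mono_tags, lifting) someI_ex)+
  show eq: "M *v (matrix_inv M *v r) = r" "matrix_inv M *v (M *v r) = r"
    by (simp_all add: matrix_vector_mul_assoc MM)
  let ?z = "matrix_inv M *v r"
  have "c * (norm ?z)\<^sup>2 \<le> ?z \<bullet> r"
    using le[of ?z] by (simp add: eq)
  also have "\<dots> \<le> norm ?z * norm r" by (rule norm_cauchy_schwarz)
  finally have "norm ?z * (c * norm ?z) \<le> norm ?z * norm r"
    by (simp add: power2_eq_square mult_ac)
  then have "c * norm ?z \<le> norm r"
    by (cases "?z = 0") auto
  then show "norm ?z \<le> norm r / c" using c by (simp add: le_divide_eq mult.commute)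
qed

lemma pd_mult_matrix_inv:
  fixes M :: "real^'n^'n"
  assumes "pd M"
  shows "M *v (matrix_inv M *v r) = r"
  using coercive_matrix_inverse(1) pd_coercive[OF assms] by metis

lemma pd_Cauchy_Schwarz:
  fixes M :: "real^'n^'n"
  assumes "pd M"
  shows "(x \<bullet> (M *v y))\<^sup>2 \<le> (x \<bullet> (M *v x)) * (y \<bullet> (M *v y))"
proof (cases "y = 0")
  case False
  let ?a = "x \<bullet> (M *v x)" and ?b = "x \<bullet> (M *v y)" and ?c = "y \<bullet> (M *v y)"
  have c: "?c > 0" using assms False by (simp add: pd_def)
  have yx: "y \<bullet> (M *v x) = ?b"
    using assms inner_matrix_vector_symmetric[of M y x] by (simp add: pd_def inner_commute)
  have "0 \<le> z \<bullet> (M *v z)" for z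
    using assms by (cases "z = 0") (auto simp: pd_def intro: less_imp_le)
  from this[of "?c *\<^sub>R x - ?b *\<^sub>R y"] have "0 \<le> ?c * (?c * ?a - ?b\<^sup>2)"
    by (simp add: matrix_vector_mult_diff_distrib matrix_vector_mult_scaleR inner_diff_left
        inner_diff_right yx power2_eq_square algebra_simps)
  then show ?thesis using c by (simp add: zero_le_mult_iff mult.commute)
qed simp

section \<open>The input ellipsoid\<close>

text \<open>
  The hypothesis compares \<open>\<xi>\<close> with the support function \<open>u \<mapsto> \<bar>R u\<bar>\<close> of the image of the unit ball under
  \<open>R\<close>. That image is compact and convex, so a point outside it is separated from it by some \<open>u\<close>. No
  inverse of \<open>R\<close> appears, so \<open>R\<close> may be singular; this matters for \<open>R = (K Q K\<^sup>T)\<^sup>1\<^sup>/\<^sup>2\<close>.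
\<close>

lemma in_matrix_image_of_ball:
  fixes R :: "real^'n^'n"
  assumes sym: "transpose R = R" and le: "\<And>u. u \<bullet> \<xi> \<le> norm (R *v u)"
  shows "\<exists>y. norm y \<le> 1 \<and> \<xi> = R *v y"
proof (rule ccontr)
  assume neg: "\<not> ?thesis"
  let ?S = "(*v) R ` cball 0 1"
  have "convex ?S" by (intro convex_linear_image) auto
  moreover have "closed ?S"
    by (intro compact_imp_closed compact_continuous_image linear_continuous_on
        matrix_vector_mul_bounded_linear compact_cball)
  moreover have "\<xi> \<notin> ?S" using neg by auto
  ultimately obtain a b where ab: "a \<bullet> \<xi> < b" "\<And>x. x \<in> ?S \<Longrightarrow> b < a \<bullet> x"
    using separating_hyperplane_closed_point by metis
  define z where "z = R *v a"
  have "(- a) \<bullet> \<xi> \<le> norm z"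
    using le[of "- a"] by (simp add: z_def matrix_vector_mult_uminus_right)
  \<comment> \<open>The point of the ball where \<open>a \<bullet> R y\<close> is least; it is \<open>0\<close> if \<open>z = 0\<close>.\<close>
  define y where "y = - (1 / norm z) *\<^sub>R z"
  have "norm y \<le> 1" by (simp add: y_def)
  then have "b < a \<bullet> (R *v y)" using ab(2) by auto
  also have "a \<bullet> (R *v y) = z \<bullet> y"
    by (simp add: z_def inner_matrix_vector_symmetric[OF sym])
  also have "\<dots> = - norm z"
    by (simp add: y_def dot_square_norm power2_eq_square)
  finally show False using ab(1) \<open>(- a) \<bullet> \<xi> \<le> norm z\<close> by simp
qed

text \<open>
  With \<open>\<eta> = Q y\<close>, the Cauchy-Schwarz inequality of the form \<open>Q\<close> gives
  \<open>(u \<bullet> K \<eta>)\<^sup>2 = (K\<^sup>T u \<bullet> Q y)\<^sup>2 \<le> (u \<bullet> K Q K\<^sup>T u) (y \<bullet> Q y)\<close>, and the last factor is at most \<open>1\<close>.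
\<close>

lemma input_ellipsoid_of_state_ellipsoid:
  fixes Q :: "real^'x^'x" and K :: "real^'x^'u"
  assumes Q: "pd Q" and \<eta>: "\<eta> \<in> state_ellipsoid Q"
  shows "K *v \<eta> \<in> input_ellipsoid K Q"
proof -
  define M where "M = K ** Q ** transpose K"
  have quad: "u \<bullet> (M *v u) = (u v* K) \<bullet> (Q *v (u v* K))" for u
    by (simp add: M_def matrix_vector_mul_assoc[symmetric] dot_lmul_matrix)
  have Qnn: "0 \<le> z \<bullet> (Q *v z)" for z
    using Q by (cases "z = 0") (auto simp: pd_def intro: less_imp_le)
  have "transpose M = M"
    using Q by (simp add: M_def matrix_transpose_mul pd_def matrix_mul_assoc)
  then have "psd M" by (simp add: psd_def quad Qnn)
  note sqrt = mat_sqrt_psd[OF this]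
  define R where "R = mat_sqrt M"
  have Rsym: "transpose R = R" using sqrt by (simp add: R_def psd_def)
  have "u \<bullet> (K *v \<eta>) \<le> norm (R *v u)" for u
  proof -
    define y where "y = matrix_inv Q *v \<eta>"
    have Qy: "Q *v y = \<eta>" by (simp add: y_def pd_mult_matrix_inv[OF Q])
    have y1: "y \<bullet> (Q *v y) \<le> 1"
      using \<eta> by (simp add: Qy state_ellipsoid_def y_def[symmetric] inner_commute)
    have "(u \<bullet> (K *v \<eta>))\<^sup>2 = ((u v* K) \<bullet> (Q *v y))\<^sup>2"
      by (simp add: Qy dot_lmul_matrix)
    also have "\<dots> \<le> (u \<bullet> (M *v u)) * (y \<bullet> (Q *v y))"
      unfolding quad by (rule pd_Cauchy_Schwarz[OF Q])
    also have "\<dots> \<le> u \<bullet> (M *v u)"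
      using y1 Qnn by (simp add: quad mult_left_le)
    also have "M = R ** R" using sqrt by (simp add: R_def)
    also have "u \<bullet> ((R ** R) *v u) = (norm (R *v u))\<^sup>2"
      by (simp add: matrix_vector_mul_assoc[symmetric] inner_matrix_vector_symmetric[OF Rsym]
          power2_norm_eq_inner)
    finally show ?thesis by (rule power2_le_imp_le) simp
  qed
  from in_matrix_image_of_ball[OF Rsym this] show ?thesis
    by (auto simp: input_ellipsoid_def R_def M_def)
qed

section \<open>The inverse of an affine matrix path\<close>

text \<open>
  Subtracting \<open>Q(t) y(t) = \<eta>(t)\<close> from \<open>Q(s) y(s) = \<eta>(s)\<close> gives
  \<open>y(s) - y(t) = Q(s)\<^sup>-\<^sup>1 (\<eta>(s) - \<eta>(t) - (s - t) Q1 y(t))\<close>. Coercivity bounds \<open>Q(s)\<^sup>-\<^sup>1\<close> by \<open>1 / c\<close>, so limits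
  can be taken inside the bracket without knowing beforehand that \<open>s \<mapsto> Q(s)\<^sup>-\<^sup>1\<close> is continuous.
\<close>

lemma
  fixes Q0 Q1 :: "real^'n^'n" and \<eta> :: "real \<Rightarrow> real^'n" and T :: "real set"
  defines "Q \<equiv> \<lambda>s. Q0 + s *\<^sub>R Q1"
  defines "y \<equiv> \<lambda>s. matrix_inv (Q s) *v \<eta> s"
  assumes c: "c > 0" and coercive: "\<And>s z. s \<in> T \<Longrightarrow> c * (norm z)\<^sup>2 \<le> z \<bullet> (Q s *v z)"
  shows continuous_on_affine_inverse: "continuous_on T \<eta> \<Longrightarrow> continuous_on T y"
    and affine_inverse_has_vector_derivative:
      "t \<in> T \<Longrightarrow> (\<eta> has_vector_derivative \<eta>') (at t within T) \<Longrightarrow>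
       (y has_vector_derivative matrix_inv (Q t) *v (\<eta>' - Q1 *v y t)) (at t within T)"
proof -
  note inv = coercive_matrix_inverse[OF c coercive]
  have Qst: "Q s *v z = Q t *v z + (s - t) *\<^sub>R (Q1 *v z)" for s t z
    by (simp add: Q_def algebra_simps scaleR_matrix_vector_assoc[symmetric])
  have diff: "y s - y t = matrix_inv (Q s) *v (\<eta> s - \<eta> t - (s - t) *\<^sub>R (Q1 *v y t))"
    if "s \<in> T" "t \<in> T" for s t
  proof -
    have "\<eta> s - \<eta> t - (s - t) *\<^sub>R (Q1 *v y t) = Q s *v (y s - y t)"
      unfolding matrix_vector_mult_diff_distrib Qst[of s "y t" t]
      by (simp add: y_def inv(1)[OF that(1)] inv(1)[OF that(2)])
    then show ?thesis by (simp add: inv(2)[OF that(1)])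
  qed
  {
    assume cont: "continuous_on T \<eta>"
    show "continuous_on T y"
      unfolding continuous_on_def
    proof
      fix t assume t: "t \<in> T"
      have "((\<lambda>s. norm (\<eta> s - \<eta> t - (s - t) *\<^sub>R (Q1 *v y t)) / c) \<longlongrightarrow>
          norm (\<eta> t - \<eta> t - (t - t) *\<^sub>R (Q1 *v y t)) / c) (at t within T)"
        using c by (intro tendsto_intros cont[unfolded continuous_on_def, rule_format, OF t]) auto
      then have lim: "((\<lambda>s. norm (\<eta> s - \<eta> t - (s - t) *\<^sub>R (Q1 *v y t)) / c) \<longlongrightarrow> 0) (at t within T)"
        by simp
      have "norm (y s - y t) \<le> norm (\<eta> s - \<eta> t - (s - t) *\<^sub>R (Q1 *v y t)) / c" if "s \<in> T" for s
        unfolding diff[OF that t] by (rule inv(3)[OF that])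
      then have "((\<lambda>s. y s - y t) \<longlongrightarrow> 0) (at t within T)"
        by (intro Lim_null_comparison[OF _ lim]) (simp add: eventually_at_filter)
      then show "(y \<longlongrightarrow> y t) (at t within T)"
        using LIM_zero_iff by blast
    qed
  }
  assume t: "t \<in> T" and deriv: "(\<eta> has_vector_derivative \<eta>') (at t within T)"
  \<comment> \<open>The remainder of \<open>y\<close> is \<open>Q(s)\<^sup>-\<^sup>1\<close> applied to that of \<open>\<eta>\<close>, up to a term of second order in \<open>s - t\<close>.\<close>
  define d where "d = \<eta>' - Q1 *v y t"
  define b where "b s = \<eta> s - \<eta> t - (s - t) *\<^sub>R \<eta>'" for s
  define p where "p = Q1 *v (matrix_inv (Q t) *v d)"
  have eq: "y s - y t - (s - t) *\<^sub>R (matrix_inv (Q t) *v d) = matrix_inv (Q s) *v (b s - (s - t)\<^sup>2 *\<^sub>R p)"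
    if s: "s \<in> T" for s
  proof -
    have "Q s *v (matrix_inv (Q t) *v d) = d + (s - t) *\<^sub>R p"
      unfolding Qst[of s _ t] p_def by (simp add: inv(1)[OF t])
    then have "matrix_inv (Q t) *v d = matrix_inv (Q s) *v (d + (s - t) *\<^sub>R p)"
      by (metis inv(2)[OF s])
    then have "y s - y t - (s - t) *\<^sub>R (matrix_inv (Q t) *v d) = matrix_inv (Q s) *v
        (\<eta> s - \<eta> t - (s - t) *\<^sub>R (Q1 *v y t) - (s - t) *\<^sub>R (d + (s - t) *\<^sub>R p))"
      unfolding diff[OF s t] by (simp add: matrix_vector_mult_diff_distrib matrix_vector_mult_scaleR)
    also have "\<eta> s - \<eta> t - (s - t) *\<^sub>R (Q1 *v y t) - (s - t) *\<^sub>R (d + (s - t) *\<^sub>R p)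
        = b s - (s - t)\<^sup>2 *\<^sub>R p"
      by (simp add: b_def d_def scaleR_diff_right scaleR_add_right power2_eq_square)
    finally show ?thesis .
  qed
  have le: "norm (norm (y s - y t - (s - t) *\<^sub>R (matrix_inv (Q t) *v d)) / norm (s - t))
      \<le> (norm (b s) / norm (s - t) + \<bar>s - t\<bar> * norm p) / c" if s: "s \<in> T" "s \<noteq> t" for s
  proof -
    define r where "r = \<bar>s - t\<bar>"
    have "norm (y s - y t - (s - t) *\<^sub>R (matrix_inv (Q t) *v d)) \<le> norm (b s - (s - t)\<^sup>2 *\<^sub>R p) / c"
      unfolding eq[OF s(1)] by (rule inv(3)[OF s(1)])
    also have "\<dots> \<le> (norm (b s) + (s - t)\<^sup>2 * norm p) / c"
      using c norm_triangle_ineq4[of "b s" "(s - t)\<^sup>2 *\<^sub>R p"] by (simp add: divide_right_mono)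
    finally have "norm (y s - y t - (s - t) *\<^sub>R (matrix_inv (Q t) *v d)) / \<bar>s - t\<bar>
        \<le> (norm (b s) + (s - t)\<^sup>2 * norm p) / c / \<bar>s - t\<bar>"
      by (rule divide_right_mono) simp
    also have "\<dots> = (norm (b s) / r + r * norm p) / c"
    proof -
      have "(s - t)\<^sup>2 = r * r" "r \<noteq> 0"
        using s by (simp_all add: r_def power2_eq_square)
      then show ?thesis
        unfolding r_def[symmetric] by (simp add: add_divide_distrib mult.commute)
    qed
    finally show ?thesis by (simp add: r_def)
  qed
  have "((\<lambda>s. norm (b s) / norm (s - t)) \<longlongrightarrow> 0) (at t within T)"
    using deriv by (simp add: has_vector_derivative_def has_derivative_iff_norm b_def)
  then have "((\<lambda>s. (norm (b s) / norm (s - t) + \<bar>s - t\<bar> * norm p) / c)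
      \<longlongrightarrow> (0 + \<bar>t - t\<bar> * norm p) / c) (at t within T)"
    using c by (intro tendsto_intros) auto
  then have lim: "((\<lambda>s. (norm (b s) / norm (s - t) + \<bar>s - t\<bar> * norm p) / c) \<longlongrightarrow> 0) (at t within T)"
    by simp
  have "((\<lambda>s. norm (y s - y t - (s - t) *\<^sub>R (matrix_inv (Q t) *v d)) / norm (s - t)) \<longlongrightarrow> 0)
      (at t within T)"
    by (rule Lim_null_comparison[OF _ lim]) (use le in \<open>simp add: eventually_at_filter\<close>)
  then show "(y has_vector_derivative matrix_inv (Q t) *v (\<eta>' - Q1 *v y t)) (at t within T)"
    by (simp add: has_vector_derivative_def has_derivative_iff_norm d_def bounded_linear_scaleR_left)
qed

section \<open>Differential inequalities holding almost everywhere\<close>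

text \<open>
  Monotonicity fails for functions that are merely continuous with a nonpositive derivative
  almost everywhere.
  Here the points where \<open>g\<close> may fail to be differentiable form a finite set, so \<open>g'\<close> is
  Henstock-Kurzweil integrable with integral \<open>g b - g a\<close>, and only the sign of \<open>g'\<close> is lost on the
  null set \<open>Z\<close>.
\<close>

lemma nonincreasing_of_AE_nonpos_derivative:
  fixes g g' :: "real \<Rightarrow> real"
  assumes "a \<le> b" "continuous_on {a..b} g" "finite S" "negligible Z"
    and deriv: "\<And>t. t \<in> {a<..<b} - S \<Longrightarrow> (g has_vector_derivative g' t) (at t)"
    and le: "\<And>t. t \<in> {a<..<b} - S - Z \<Longrightarrow> g' t \<le> 0"
  shows "g b \<le> g a"
proof -
  have int: "(g' has_integral (g b - g a)) {a..b}"
    using fundamental_theorem_of_calculus_interior_strong[OF assms(3,1) deriv assms(2)] .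
  define Z' where "Z' = Z \<union> S \<union> {a, b}"
  have neg: "negligible Z'"
    unfolding Z'_def by (intro negligible_Un assms(4) negligible_finite assms(3)) auto
  have "((\<lambda>t. if t \<in> Z' then 0 else g' t) has_integral (g b - g a)) {a..b}"
    by (rule has_integral_spike[OF neg _ int]) simp
  then have "g b - g a \<le> 0"
    by (rule has_integral_le[OF _ has_integral_0]) (use le in \<open>auto simp: Z'_def\<close>)
  then show ?thesis by simp
qed

text \<open>
  The integrating factor turns the differential inequality into monotonicity of
  \<open>(V t - 1) exp (c t)\<close>.
\<close>

lemma sublevel_invariance:
  fixes V V' :: "real \<Rightarrow> real"
  assumes ab: "a \<le> b" and cont: "continuous_on {a..b} V" and fin: "finite S" "negligible Z"
    and deriv: "\<And>t. t \<in> {a<..<b} - S \<Longrightarrow> (V has_vector_derivative V' t) (at t)"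
    and le: "\<And>t. t \<in> {a<..<b} - S - Z \<Longrightarrow> V' t \<le> c * (1 - V t)"
    and init: "V a \<le> 1"
  shows "V b \<le> 1"
proof -
  define g where "g t = (V t - 1) * exp (c * t)" for t
  define g' where "g' t = V' t * exp (c * t) + (V t - 1) * (exp (c * t) * c)" for t
  have "g b \<le> g a"
  proof (rule nonincreasing_of_AE_nonpos_derivative[OF ab _ fin])
    show "continuous_on {a..b} g"
      unfolding g_def by (intro continuous_intros cont)
    show "(g has_vector_derivative g' t) (at t)" if "t \<in> {a<..<b} - S" for t
      using deriv[OF that] unfolding g_def g'_def has_real_derivative_iff_has_vector_derivative[symmetric]
      by (auto intro!: derivative_eq_intros)
    show "g' t \<le> 0" if "t \<in> {a<..<b} - S - Z" for t
    proof -
      have "g' t = exp (c * t) * (V' t - c * (1 - V t))"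
        by (simp add: g'_def algebra_simps)
      then show ?thesis using le[OF that] by (simp add: mult_le_0_iff)
    qed
  qed
  also have "g a \<le> 0" using init by (simp add: g_def mult_le_0_iff)
  finally show ?thesis by (simp add: g_def mult_le_0_iff)
qed

lemma AE_lebesgue_on_negligible:
  fixes a b :: real
  assumes "AE t in lebesgue_on {a..b}. P t"
  obtains Z where "negligible Z" "\<And>t. t \<in> {a..b} - Z \<Longrightarrow> P t"
proof -
  obtain Z where "Z \<in> null_sets (lebesgue_on {a..b})" "{t \<in> {a..b}. \<not> P t} \<subseteq> Z"
    using assms unfolding eventually_ae_filter by auto
  then show ?thesis
    using that[of Z] by (auto simp: negligible_iff_null_sets null_sets_restrict_space)
qed

lemma admissible_norm_le_1:
  assumes "admissible a b w"
  shows "AE t in lebesgue_on {a..b}. norm (w t) \<le> 1"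
proof -
  have "AE t in lebesgue_on {a..b}. ereal (norm (w t)) \<le> 1"
    using esssup_AE[of "\<lambda>t. ereal (norm (w t))" "lebesgue_on {a..b}"] assms order_trans
    unfolding admissible_def by (elim eventually_mono) blast
  then show ?thesis by (simp add: one_ereal_def)
qed

section \<open>Block vectors\<close>

definition vjoin :: "real^'a \<Rightarrow> real^'b \<Rightarrow> real^('a + 'b)"  (infixr \<open>\<oplus>\<^sub>v\<close> 64) where
  "a \<oplus>\<^sub>v b = (\<chi> i. case i of Inl j \<Rightarrow> a $ j | Inr j \<Rightarrow> b $ j)"

lemma sum_UNIV_Plus:
  fixes g :: "'a::finite + 'b::finite \<Rightarrow> 'c::comm_monoid_add"
  shows "(\<Sum>i\<in>UNIV. g i) = (\<Sum>j\<in>UNIV. g (Inl j)) + (\<Sum>j\<in>UNIV. g (Inr j))"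
  unfolding UNIV_Plus_UNIV[symmetric] by (subst sum.Plus) auto

lemma vjoin_inner: "(a \<oplus>\<^sub>v b) \<bullet> (c \<oplus>\<^sub>v d) = a \<bullet> c + b \<bullet> d"
  by (simp add: inner_vec_def vjoin_def sum_UNIV_Plus)

lemma hcat_mult_vjoin: "(L ||| R) *v (a \<oplus>\<^sub>v b) = L *v a + R *v b"
  by (simp add: vec_eq_iff matrix_vector_mult_def hcat_def vjoin_def sum_UNIV_Plus)

lemma vcat_mult: "(U /// L) *v z = (U *v z) \<oplus>\<^sub>v (L *v z)"
  by (auto simp: vec_eq_iff matrix_vector_mult_def vcat_def vjoin_def split: sum.split)

lemma mult_hcat: "y v* (L ||| R) = (y v* L) \<oplus>\<^sub>v (y v* R)" for L :: "real^'n^'m"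
  by (auto simp: vec_eq_iff vector_matrix_mult_def hcat_def vjoin_def split: sum.split)

lemma vjoin_add: "(a \<oplus>\<^sub>v b) + (c \<oplus>\<^sub>v d) = (a + c) \<oplus>\<^sub>v (b + d)"
  by (auto simp: vec_eq_iff vjoin_def split: sum.split)

lemma block_diag_mult_vjoin: "block_diag U L *v (a \<oplus>\<^sub>v b) = (U *v a) \<oplus>\<^sub>v (L *v b)"
  by (simp add: block_diag_def vcat_mult hcat_mult_vjoin)

lemma mat_mult_vector: "mat c *v x = c *\<^sub>R x" for x :: "real^'n"
  by (simp add: vec_eq_iff matrix_vector_mult_def mat_def if_distrib[of "\<lambda>c. c * _"] cong: if_cong)

lemma diag_mat_mult_vector: "diag_mat d *v x = (\<chi> i. d $ i * x $ i)"
  by (simp add: vec_eq_iff matrix_vector_mult_def diag_mat_def if_distrib[of "\<lambda>c. c * _"] cong: if_cong)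

lemmas block_simps = vjoin_inner hcat_mult_vjoin vcat_mult mult_hcat vjoin_add block_diag_mult_vjoin
  mat_mult_vector diag_mat_mult_vector

section \<open>The quadratic form of the matrix inequalities\<close>

text \<open>
  The diagonal of \<open>\<Gamma>\<^sub>k\<close>.
\<close>

abbreviation gam_sup where "gam_sup P k \<equiv> (\<chi> i. SUP t\<in>seg P k. gam P t $ i)"

text \<open>
  The terms are grouped by what they depend on: first the products of data with index \<open>i\<close> and data
  with index \<open>j\<close>, then everything that is linear in the data with index \<open>j\<close>, then a remainder common to
  all \<open>i\<close> and \<open>j\<close>. Interpolation acts separately on each of the three groups. The coupling
  block in the second row is \<open>N\<^sub>2 E\<^sup>T\<close>, which is why the gains multiply \<open>E z\<close> as well as \<open>z \<bullet> z\<close>.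
\<close>

lemma H_quadratic_form:
  fixes P :: "('x::finite, 'u::finite, 'w::finite, 'q::finite, 'p::finite, 'e1::finite, 'e2::finite,
               'e3::finite, 'c1::finite, 'c2::finite, 'c3::finite) sdp_data"
    and v :: "('x, 'u, ('x, 'w, 'q, 'p, 'e1, 'e2, 'e3, 'c1, 'c2, 'c3) H_index) sdp_vars"
    and y :: "real^'x" and w :: "real^'w"
    and z1 :: "real^'e1" and z2 :: "real^'e2" and z3 :: "real^'e3" and z4 :: "real^'p"
    and s1 :: "real^'c1" and s2 :: "real^'c2" and s3 :: "real^'c3" and s4 :: "real^'q"
  defines "\<zeta> \<equiv> y \<oplus>\<^sub>v (z1 \<oplus>\<^sub>v z2 \<oplus>\<^sub>v z3 \<oplus>\<^sub>v z4) \<oplus>\<^sub>v w \<oplus>\<^sub>v (s1 \<oplus>\<^sub>v s2 \<oplus>\<^sub>v s3 \<oplus>\<^sub>v s4)"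
  assumes sym: "transpose (Q_var v j) = Q_var v j"
  shows "\<zeta> \<bullet> (H_mat P v k i j *v \<zeta>) =
      - (2 * (y \<bullet> (A_jac P (node P i) *v (Q_var v j *v y)))
         + 2 * (y \<bullet> (B_jac P (node P i) *v (Y_var v j *v y))))
      - (lam_w P * (y \<bullet> (Q_var v j *v y)) + 2 * (y \<bullet> (F_jac P (node P j) *v w))
         + lam_beta_eta v j * ((SUP t\<in>seg P k. beta_eta P t)\<^sup>2 * (2 * (y \<bullet> (E_eta P *v z1)) - z1 \<bullet> z1)
             - s1 \<bullet> s1) + 2 * (s1 \<bullet> (C_eta P *v (Q_var v j *v y)))
         + lam_beta_xi v j * ((SUP t\<in>seg P k. beta_xi P t)\<^sup>2 * (2 * (y \<bullet> (E_xi P *v z2)) - z2 \<bullet> z2)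
             - s2 \<bullet> s2) + 2 * (s2 \<bullet> (D_xi P *v (Y_var v j *v y)))
         + lam_beta_w v j * ((SUP t\<in>seg P k. beta_w P t)\<^sup>2 * (2 * (y \<bullet> (E_w P *v z3)) - z3 \<bullet> z3)
             - s3 \<bullet> s3) + 2 * (s3 \<bullet> (G_w P *v w))
         + lam_gam v j * (2 * (y \<bullet> (E_o P *v (\<chi> i. (gam_sup P k $ i)\<^sup>2 * z4 $ i)))
             - z4 \<bullet> (\<chi> i. (gam_sup P k $ i)\<^sup>2 * z4 $ i) - (s4 \<bullet> s4) / real CARD('p))
         + 2 * (s4 \<bullet> (C_o P *v (Q_var v j *v y) + D_o P *v (Y_var v j *v y) + G_o P *v w)))
      + (y \<bullet> (((1 / (node P (Suc k) - node P k)) *\<^sub>R (Q_var v (Suc k) - Q_var v k)) *v y)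
         + lam_w P * (w \<bullet> w))"
proof -
  define g where "g = gam_sup P k"
  have tr: "a \<bullet> (b v* M) = b \<bullet> (M *v a)" for a :: "real^'k" and b :: "real^'l" and M
    by (simp add: inner_commute[of a] dot_lmul_matrix)
  have E: "z4 \<bullet> (\<chi> i. g $ i * (g $ i * (y v* M) $ i)) = y \<bullet> (M *v (\<chi> i. (g $ i)\<^sup>2 * z4 $ i))"
    for g :: "real^'p" and M
  proof -
    have "z4 \<bullet> (\<chi> i. g $ i * (g $ i * (y v* M) $ i)) = (y v* M) \<bullet> (\<chi> i. (g $ i)\<^sup>2 * z4 $ i)"
      by (simp add: inner_vec_def power2_eq_square mult_ac)
    then show ?thesis by (simp add: dot_lmul_matrix)
  qed
  have QA: "y \<bullet> (Q_var v j *v (y v* M)) = y \<bullet> (M *v (Q_var v j *v y))" for M :: "real^'x^'x"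
    by (simp add: inner_matrix_vector_symmetric[OF sym] tr)
  have sq: "(\<chi> i. g $ i * (g $ i * z4 $ i)) = (\<chi> i. (g $ i)\<^sup>2 * z4 $ i)" for g :: "real^'p"
    by (simp add: power2_eq_square mult.assoc)
  show ?thesis
    unfolding \<zeta>_def H_mat_def Let_def N1_mat_def N2_mat_def W_mat_def E_stack_def C_stack_def
      D_stack_def G_stack_def Gam_mat_def g_def[symmetric]
    by (simp add: block_simps matrix_vector_mult_uminus_left matrix_vector_mult_add_rdistrib
        matrix_vector_mult_diff_rdistrib matrix_vector_mul_assoc[symmetric]
        scaleR_matrix_vector_assoc[symmetric] tr dot_lmul_matrix QA E sq inner_add_right inner_diff_right)
      (simp add: algebra_simps)
qed

text \<open>
  With weights \<open>\<sigma>\<close> and \<open>\<tau>\<close>, \<open>lmi_a\<close> bounds each of the three terms from below by zero. Under \<open>lmi_b\<close>,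
  evaluating the big block matrix at the stacked vector \<open>(\<sigma> \<zeta>, \<tau> \<zeta>)\<close> bounds the combination from below by
  the one with \<open>X\<^sup>k\<^sub>i\<^sub>j\<close> in place of \<open>H\<^sup>k\<^sub>i\<^sub>j\<close>, in which every term is nonnegative.
\<close>

lemma H_interpolated_nonneg:
  assumes lmi: "lmi_a P v k \<or> lmi_b P v k" and st: "0 \<le> \<sigma>" "0 \<le> \<tau>"
  shows "0 \<le> \<sigma>\<^sup>2 * (\<zeta> \<bullet> (H_mat P v k k k *v \<zeta>)) + \<tau>\<^sup>2 * (\<zeta> \<bullet> (H_mat P v k (Suc k) (Suc k) *v \<zeta>))
      + \<sigma> * \<tau> * (\<zeta> \<bullet> (H_mat P v k k (Suc k) *v \<zeta>) + \<zeta> \<bullet> (H_mat P v k (Suc k) k *v \<zeta>))"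
proof -
  define h where "h i j = \<zeta> \<bullet> (H_mat P v k i j *v \<zeta>)" for i j
  have "0 \<le> \<sigma>\<^sup>2 * h k k + \<tau>\<^sup>2 * h (Suc k) (Suc k) + \<sigma> * \<tau> * (h k (Suc k) + h (Suc k) k)"
    using lmi
  proof
    assume "lmi_a P v k"
    then have "0 \<le> h k k" "0 \<le> h (Suc k) (Suc k)" "0 \<le> h k (Suc k) + h (Suc k) k"
      unfolding lmi_a_def psd_def h_def inner_add_right[symmetric]
        matrix_vector_mult_add_rdistrib[symmetric] by blast+
    then show ?thesis
      using st by (intro add_nonneg_nonneg[of "_ + _"] add_nonneg_nonneg[of "_ * h k k"] mult_nonneg_nonneg) simp_all
  next
    assume b: "lmi_b P v k"
    define X where "X i j = \<zeta> \<bullet> (X_var v k i j *v \<zeta>)" for i j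
    have X: "0 \<le> X k k" "0 \<le> X (Suc k) (Suc k)" "0 \<le> X (Suc k) k"
      using b unfolding lmi_b_def psd_def X_def by blast+
    define m where "m = (h k (Suc k) + h (Suc k) k) / 2 - X (Suc k) k"
    define M where "M = (1 / 2) *\<^sub>R (H_mat P v k k (Suc k) + H_mat P v k (Suc k) k) - X_var v k (Suc k) k"
    define z where "z = \<sigma> *\<^sub>R \<zeta> \<oplus>\<^sub>v \<tau> *\<^sub>R \<zeta>"
    have m: "\<zeta> \<bullet> (M *v \<zeta>) = m"
      by (simp add: M_def m_def h_def X_def matrix_vector_mult_diff_rdistrib
          matrix_vector_mult_add_rdistrib scaleR_matrix_vector_assoc[symmetric] inner_diff_right
          inner_add_right)
    have mt: "\<zeta> \<bullet> (\<zeta> v* M) = m"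
      by (subst inner_commute) (simp only: dot_lmul_matrix m)
    have "0 \<le> z \<bullet> (((H_mat P v k k k - X_var v k k k ||| transpose M) ///
              (M ||| H_mat P v k (Suc k) (Suc k) - X_var v k (Suc k) (Suc k))) *v z)"
      using b unfolding lmi_b_def psd_def Let_def M_def by blast
    also have "\<dots> = \<sigma>\<^sup>2 * (h k k - X k k) + \<tau>\<^sup>2 * (h (Suc k) (Suc k) - X (Suc k) (Suc k)) + 2 * (\<sigma> * \<tau>) * m"
      by (simp add: z_def block_simps matrix_vector_mult_scaleR scaleR_vector_matrix_assoc
          inner_add_right m mt h_def X_def matrix_vector_mult_diff_rdistrib inner_diff_right
          power2_eq_square algebra_simps)
    also have "2 * (\<sigma> * \<tau>) * m = \<sigma> * \<tau> * (h k (Suc k) + h (Suc k) k) - 2 * (\<sigma> * \<tau> * X (Suc k) k)"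
      by (simp add: m_def right_diff_distrib)
    finally have "0 \<le> \<sigma>\<^sup>2 * (h k k - X k k) + \<tau>\<^sup>2 * (h (Suc k) (Suc k) - X (Suc k) (Suc k))
        + \<sigma> * \<tau> * (h k (Suc k) + h (Suc k) k) - 2 * (\<sigma> * \<tau> * X (Suc k) k)"
      by simp
    moreover have "0 \<le> \<sigma>\<^sup>2 * X k k" "0 \<le> \<tau>\<^sup>2 * X (Suc k) (Suc k)" "0 \<le> \<sigma> * \<tau> * X (Suc k) k"
      using X st by simp_all
    ultimately show ?thesis by (simp add: right_diff_distrib)
  qed
  then show ?thesis by (simp add: h_def)
qed

text \<open>
  The weights \<open>\<sigma>\<^sub>i \<sigma>\<^sub>j\<close> sum to \<open>1\<close>, and to \<open>\<sigma>\<^sub>j\<close> for fixed \<open>j\<close>.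
\<close>

lemma convex_combination_bilinear:
  fixes \<alpha> :: "nat \<Rightarrow> nat \<Rightarrow> real"
  assumes "\<sigma> + \<tau> = (1::real)"
  shows "\<sigma>\<^sup>2 * (- \<alpha> k k - \<theta> k + \<kappa>) + \<tau>\<^sup>2 * (- \<alpha> l l - \<theta> l + \<kappa>)
      + \<sigma> * \<tau> * ((- \<alpha> k l - \<theta> l + \<kappa>) + (- \<alpha> l k - \<theta> k + \<kappa>))
    = - (\<sigma>\<^sup>2 * \<alpha> k k + \<tau>\<^sup>2 * \<alpha> l l + \<sigma> * \<tau> * (\<alpha> k l + \<alpha> l k)) - (\<sigma> * \<theta> k + \<tau> * \<theta> l) + \<kappa>"
proof -
  have \<tau>: "\<tau> = 1 - \<sigma>" using assms by simp
  show ?thesis unfolding \<tau> by (simp add: power2_eq_square algebra_simps)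
qed

section \<open>Elimination of the uncertainty channels\<close>

text \<open>
  The S-procedure for one channel. The choice of \<open>z\<close> makes the cross term equal to \<open>2 y \<bullet> E p\<close>, and that of
  \<open>s\<close> maximizes the right-hand side. The two sides then differ by \<open>(\<bar>c\<bar>\<^sup>2 - \<bar>p\<bar>\<^sup>2 / \<beta>\<^sup>2) / l\<close>, and the norm
  bound makes this nonnegative.
\<close>

lemma channel_multipliers:
  fixes p :: "real^'e" and c :: "real^'c" and E :: "real^'e^'x" and y :: "real^'x"
  assumes l: "0 < l" and \<beta>: "0 < \<beta>" and p: "norm p \<le> \<beta> * norm c"
  defines "z \<equiv> (1 / (\<beta>\<^sup>2 * l)) *\<^sub>R p" and "s \<equiv> (1 / l) *\<^sub>R c"
  shows "2 * (y \<bullet> (E *v p)) \<le> l * (\<beta>\<^sup>2 * (2 * (y \<bullet> (E *v z)) - z \<bullet> z) - s \<bullet> s) + 2 * (s \<bullet> c)"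
proof -
  have "p \<bullet> p \<le> \<beta>\<^sup>2 * (c \<bullet> c)"
    using power_mono[OF p, of 2] by (simp add: power_mult_distrib power2_norm_eq_inner)
  then have "(p \<bullet> p) / \<beta>\<^sup>2 \<le> c \<bullet> c"
    using \<beta> by (simp add: divide_le_eq mult.commute)
  then have "0 \<le> (c \<bullet> c - (p \<bullet> p) / \<beta>\<^sup>2) / l"
    using l by simp
  also have "\<dots> = l * (\<beta>\<^sup>2 * (2 * (y \<bullet> (E *v z)) - z \<bullet> z) - s \<bullet> s) + 2 * (s \<bullet> c) - 2 * (y \<bullet> (E *v p))"
    using l \<beta> by (simp add: z_def s_def matrix_vector_mult_scaleR field_simps power2_eq_square)
  finally show ?thesis by simp
qed

text \<open>
  The same for a channel that is bounded entry by entry. Each of its \<open>CARD('p)\<close> entries is compared with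
  the same output \<open>c\<close>, so summing the bounds yields \<open>\<Sum>\<^sub>i p\<^sub>i\<^sup>2 / g\<^sub>i\<^sup>2 \<le> CARD('p) \<bar>c\<bar>\<^sup>2\<close>; this is the origin of the
  factor \<open>1 / CARD('p)\<close> in \<open>N\<^sub>1\<close>.
\<close>

lemma Lipschitz_channel_multipliers:
  fixes p g :: "real^'p" and c :: "real^'q" and E :: "real^'p^'x" and y :: "real^'x"
  assumes l: "0 < l" and g: "\<And>i. 0 < g $ i" and p: "\<And>i. \<bar>p $ i\<bar> \<le> g $ i * norm c"
  defines "z \<equiv> (\<chi> i. p $ i / ((g $ i)\<^sup>2 * l))" and "s \<equiv> (real CARD('p) / l) *\<^sub>R c"
  shows "2 * (y \<bullet> (E *v p)) \<le>
    l * (2 * (y \<bullet> (E *v (\<chi> i. (g $ i)\<^sup>2 * z $ i))) - z \<bullet> (\<chi> i. (g $ i)\<^sup>2 * z $ i)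
      - (s \<bullet> s) / real CARD('p)) + 2 * (s \<bullet> c)"
proof -
  have gi: "g $ i \<noteq> 0" for i using g[of i] by simp
  have gz: "(\<chi> i. (g $ i)\<^sup>2 * z $ i) = (1 / l) *\<^sub>R p"
    using gi by (simp add: z_def vec_eq_iff)
  have "(p $ i)\<^sup>2 / (g $ i)\<^sup>2 \<le> c \<bullet> c" for i
  proof -
    have "(p $ i)\<^sup>2 \<le> (g $ i)\<^sup>2 * (c \<bullet> c)"
      using power_mono[OF p[of i], of 2] by (simp add: power_mult_distrib power2_norm_eq_inner)
    then show ?thesis using gi[of i] by (simp add: divide_le_eq mult.commute)
  qed
  then have "(\<Sum>i\<in>UNIV. (p $ i)\<^sup>2 / (g $ i)\<^sup>2) \<le> (\<Sum>i\<in>(UNIV::'p set). c \<bullet> c)"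
    by (intro sum_mono)
  then have sum: "(\<Sum>i\<in>UNIV. (p $ i)\<^sup>2 / (g $ i)\<^sup>2) \<le> real CARD('p) * (c \<bullet> c)"
    by simp
  define N where "N = c \<bullet> c"
  define T where "T = (\<Sum>i\<in>UNIV. (p $ i)\<^sup>2 / (g $ i)\<^sup>2)"
  define m where "m = real CARD('p)"
  have m: "m \<noteq> 0" by (simp add: m_def)
  have zp: "z \<bullet> ((1 / l) *\<^sub>R p) = T / (l * l)"
    unfolding inner_vec_def z_def T_def sum_divide_distrib
    by (intro sum.cong) (simp_all add: power2_eq_square)
  have ss: "s \<bullet> s = m * (m * N) / (l * l)" "s \<bullet> c = m * N / l"
    by (simp_all add: s_def m_def N_def)
  have "0 \<le> (m * N - T) / l"
    using sum l by (simp add: T_def m_def N_def)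
  also have "\<dots> = l * (2 * ((y \<bullet> (E *v p)) / l) - T / (l * l) - m * (m * N) / (l * l) / m)
      + 2 * (m * N / l) - 2 * (y \<bullet> (E *v p))"
    using l m by (simp add: right_diff_distrib diff_divide_distrib)
  finally show ?thesis
    unfolding gz zp ss m_def[symmetric] by (simp add: matrix_vector_mult_scaleR)
qed

text \<open>
  In the application \<open>y = Q\<^sup>-\<^sup>1 \<eta>\<close>, so that \<open>Q y = \<eta>\<close>, and \<open>Y y = K \<eta>\<close>, the first bracket is \<open>\<eta>'\<close> and \<open>y \<bullet> Q y\<close> is the
  Lyapunov function. The multipliers in \<open>N\<^sub>1\<close> and \<open>N\<^sub>2\<close> interpolate to the same \<open>l1, ..., l4\<close>, so
  the terms of one channel coming from \<open>N\<^sub>1\<close> and from \<open>N\<^sub>2\<close> can be compared.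
\<close>

lemma dissipation_inequality:
  fixes P :: "('x::finite, 'u::finite, 'w::finite, 'q::finite, 'p::finite, 'e1::finite, 'e2::finite,
               'e3::finite, 'c1::finite, 'c2::finite, 'c3::finite) sdp_data"
    and v :: "('x, 'u, ('x, 'w, 'q, 'p, 'e1, 'e2, 'e3, 'c1, 'c2, 'c3) H_index) sdp_vars"
    and y :: "real^'x" and w :: "real^'w"
    and p1 :: "real^'e1" and p2 :: "real^'e2" and p3 :: "real^'e3" and p4 :: "real^'p"
  assumes lmi: "lmi_a P v k \<or> lmi_b P v k"
    and sym: "\<And>j. j \<in> {k, Suc k} \<Longrightarrow> transpose (Q_var v j) = Q_var v j"
    and lam: "\<And>j. j \<in> {k, Suc k} \<Longrightarrow>
      0 < lam_beta_eta v j \<and> 0 < lam_beta_xi v j \<and> 0 < lam_beta_w v j \<and> 0 < lam_gam v j"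
    and st: "0 \<le> \<sigma>" "0 \<le> \<tau>" "\<sigma> + \<tau> = 1"
  defines "A \<equiv> \<sigma> *\<^sub>R A_jac P (node P k) + \<tau> *\<^sub>R A_jac P (node P (Suc k))"
    and "B \<equiv> \<sigma> *\<^sub>R B_jac P (node P k) + \<tau> *\<^sub>R B_jac P (node P (Suc k))"
    and "F \<equiv> \<sigma> *\<^sub>R F_jac P (node P k) + \<tau> *\<^sub>R F_jac P (node P (Suc k))"
    and "Q \<equiv> \<sigma> *\<^sub>R Q_var v k + \<tau> *\<^sub>R Q_var v (Suc k)"
    and "Y \<equiv> \<sigma> *\<^sub>R Y_var v k + \<tau> *\<^sub>R Y_var v (Suc k)"
    and "Qdot \<equiv> (1 / (node P (Suc k) - node P k)) *\<^sub>R (Q_var v (Suc k) - Q_var v k)"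
  assumes pos: "0 < (SUP t\<in>seg P k. beta_eta P t)" "0 < (SUP t\<in>seg P k. beta_xi P t)"
      "0 < (SUP t\<in>seg P k. beta_w P t)" "\<And>i. 0 < gam_sup P k $ i"
    and p1: "norm p1 \<le> (SUP t\<in>seg P k. beta_eta P t) * norm (C_eta P *v (Q *v y))"
    and p2: "norm p2 \<le> (SUP t\<in>seg P k. beta_xi P t) * norm (D_xi P *v (Y *v y))"
    and p3: "norm p3 \<le> (SUP t\<in>seg P k. beta_w P t) * norm (G_w P *v w)"
    and p4: "\<And>i. \<bar>p4 $ i\<bar> \<le>
      gam_sup P k $ i * norm (C_o P *v (Q *v y) + D_o P *v (Y *v y) + G_o P *v w)"
  shows "2 * (y \<bullet> (A *v (Q *v y) + B *v (Y *v y) + F *v w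
      + E_eta P *v p1 + E_xi P *v p2 + E_w P *v p3 + E_o P *v p4)) - y \<bullet> (Qdot *v y)
      \<le> lam_w P * (w \<bullet> w - y \<bullet> (Q *v y))"
proof -
  define b1 where "b1 = (SUP t\<in>seg P k. beta_eta P t)"
  define b2 where "b2 = (SUP t\<in>seg P k. beta_xi P t)"
  define b3 where "b3 = (SUP t\<in>seg P k. beta_w P t)"
  define g where "g = gam_sup P k"
  define l1 where "l1 = \<sigma> * lam_beta_eta v k + \<tau> * lam_beta_eta v (Suc k)"
  define l2 where "l2 = \<sigma> * lam_beta_xi v k + \<tau> * lam_beta_xi v (Suc k)"
  define l3 where "l3 = \<sigma> * lam_beta_w v k + \<tau> * lam_beta_w v (Suc k)"
  define l4 where "l4 = \<sigma> * lam_gam v k + \<tau> * lam_gam v (Suc k)"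
  have conv: "0 < \<sigma> * a + \<tau> * b" if "0 < a" "0 < b" for a b :: real
    using that st by (cases "\<sigma> = 0") (auto intro: add_pos_nonneg)
  have l: "0 < l1" "0 < l2" "0 < l3" "0 < l4"
    unfolding l1_def l2_def l3_def l4_def using lam by (auto intro!: conv)
  \<comment> \<open>Channel values divided by the blocks of \<open>N\<^sub>2\<close>, outputs divided by the blocks of \<open>N\<^sub>1\<close>.\<close>
  define z1 where "z1 = (1 / (b1\<^sup>2 * l1)) *\<^sub>R p1"
  define z2 where "z2 = (1 / (b2\<^sup>2 * l2)) *\<^sub>R p2"
  define z3 where "z3 = (1 / (b3\<^sup>2 * l3)) *\<^sub>R p3"
  define z4 where "z4 = (\<chi> i. p4 $ i / ((g $ i)\<^sup>2 * l4))"
  define s1 where "s1 = (1 / l1) *\<^sub>R (C_eta P *v (Q *v y))"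
  define s2 where "s2 = (1 / l2) *\<^sub>R (D_xi P *v (Y *v y))"
  define s3 where "s3 = (1 / l3) *\<^sub>R (G_w P *v w)"
  define s4 where "s4 = (real CARD('p) / l4) *\<^sub>R
    (C_o P *v (Q *v y) + D_o P *v (Y *v y) + G_o P *v w)"
  define \<zeta> where "\<zeta> = y \<oplus>\<^sub>v (z1 \<oplus>\<^sub>v z2 \<oplus>\<^sub>v z3 \<oplus>\<^sub>v z4) \<oplus>\<^sub>v w \<oplus>\<^sub>v (s1 \<oplus>\<^sub>v s2 \<oplus>\<^sub>v s3 \<oplus>\<^sub>v s4)"
  \<comment> \<open>The three groups of terms in \<open>H_quadratic_form\<close>, evaluated at \<open>\<zeta>\<close>.\<close>
  define \<alpha> where "\<alpha> i j = 2 * (y \<bullet> (A_jac P (node P i) *v (Q_var v j *v y)))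
         + 2 * (y \<bullet> (B_jac P (node P i) *v (Y_var v j *v y)))" for i j
  define e1 where "e1 = b1\<^sup>2 * (2 * (y \<bullet> (E_eta P *v z1)) - z1 \<bullet> z1) - s1 \<bullet> s1"
  define e2 where "e2 = b2\<^sup>2 * (2 * (y \<bullet> (E_xi P *v z2)) - z2 \<bullet> z2) - s2 \<bullet> s2"
  define e3 where "e3 = b3\<^sup>2 * (2 * (y \<bullet> (E_w P *v z3)) - z3 \<bullet> z3) - s3 \<bullet> s3"
  define e4 where "e4 = 2 * (y \<bullet> (E_o P *v (\<chi> i. (g $ i)\<^sup>2 * z4 $ i)))
             - z4 \<bullet> (\<chi> i. (g $ i)\<^sup>2 * z4 $ i) - (s4 \<bullet> s4) / real CARD('p)"
  define \<theta> where "\<theta> j = lam_w P * (y \<bullet> (Q_var v j *v y)) + 2 * (y \<bullet> (F_jac P (node P j) *v w))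
         + lam_beta_eta v j * e1 + 2 * (s1 \<bullet> (C_eta P *v (Q_var v j *v y)))
         + lam_beta_xi v j * e2 + 2 * (s2 \<bullet> (D_xi P *v (Y_var v j *v y)))
         + lam_beta_w v j * e3 + 2 * (s3 \<bullet> (G_w P *v w))
         + lam_gam v j * e4
         + 2 * (s4 \<bullet> (C_o P *v (Q_var v j *v y) + D_o P *v (Y_var v j *v y) + G_o P *v w))" for j
  define \<kappa> where "\<kappa> = y \<bullet> (Qdot *v y) + lam_w P * (w \<bullet> w)"
  have h: "\<zeta> \<bullet> (H_mat P v k i j *v \<zeta>) = - \<alpha> i j - \<theta> j + \<kappa>" if "j \<in> {k, Suc k}" for i j
    unfolding \<zeta>_def H_quadratic_form[where v = v and P = P and j = j, OF sym[OF that]] \<alpha>_def \<theta>_def \<kappa>_def e1_def e2_def e3_def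
      e4_def Qdot_def b1_def b2_def b3_def g_def ..
  have "0 \<le> - (\<sigma>\<^sup>2 * \<alpha> k k + \<tau>\<^sup>2 * \<alpha> (Suc k) (Suc k) + \<sigma> * \<tau> * (\<alpha> k (Suc k) + \<alpha> (Suc k) k))
      - (\<sigma> * \<theta> k + \<tau> * \<theta> (Suc k)) + \<kappa>"
    using H_interpolated_nonneg[OF lmi st(1,2), of \<zeta>]
    by (simp only: h insertI1 insertI2 convex_combination_bilinear[OF st(3)])
  moreover have "\<sigma>\<^sup>2 * \<alpha> k k + \<tau>\<^sup>2 * \<alpha> (Suc k) (Suc k) + \<sigma> * \<tau> * (\<alpha> k (Suc k) + \<alpha> (Suc k) k)
      = 2 * (y \<bullet> (A *v (Q *v y))) + 2 * (y \<bullet> (B *v (Y *v y)))"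
    by (simp add: A_def B_def Q_def Y_def \<alpha>_def matrix_vector_mult_add_rdistrib
        scaleR_matrix_vector_assoc[symmetric] matrix_vector_right_distrib matrix_vector_mult_scaleR
        inner_add_right power2_eq_square algebra_simps)
  moreover have "\<sigma> * \<theta> k + \<tau> * \<theta> (Suc k) = lam_w P * (y \<bullet> (Q *v y)) + 2 * (y \<bullet> (F *v w))
      + (l1 * e1 + 2 * (s1 \<bullet> (C_eta P *v (Q *v y))))
      + (l2 * e2 + 2 * (s2 \<bullet> (D_xi P *v (Y *v y))))
      + (l3 * e3 + 2 * (s3 \<bullet> (G_w P *v w)))
      + (l4 * e4 + 2 * (s4 \<bullet> (C_o P *v (Q *v y) + D_o P *v (Y *v y) + G_o P *v w)))"
  proof -
    have \<tau>: "\<tau> = 1 - \<sigma>" using st by simp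
    show ?thesis
      unfolding \<theta>_def l1_def l2_def l3_def l4_def F_def Q_def Y_def \<tau>
      by (simp add: matrix_vector_mult_add_rdistrib matrix_vector_mult_diff_rdistrib
        scaleR_matrix_vector_assoc[symmetric] matrix_vector_right_distrib matrix_vector_mult_scaleR
        inner_add_right inner_diff_right algebra_simps)
  qed
  moreover have "2 * (y \<bullet> (E_eta P *v p1)) \<le> l1 * e1 + 2 * (s1 \<bullet> (C_eta P *v (Q *v y)))"
    unfolding e1_def z1_def s1_def
    by (rule channel_multipliers[OF l(1)]) (use pos p1 in \<open>simp_all add: b1_def\<close>)
  moreover have "2 * (y \<bullet> (E_xi P *v p2)) \<le> l2 * e2 + 2 * (s2 \<bullet> (D_xi P *v (Y *v y)))"
    unfolding e2_def z2_def s2_def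
    by (rule channel_multipliers[OF l(2)]) (use pos p2 in \<open>simp_all add: b2_def\<close>)
  moreover have "2 * (y \<bullet> (E_w P *v p3)) \<le> l3 * e3 + 2 * (s3 \<bullet> (G_w P *v w))"
    unfolding e3_def z3_def s3_def
    by (rule channel_multipliers[OF l(3)]) (use pos p3 in \<open>simp_all add: b3_def\<close>)
  moreover have "2 * (y \<bullet> (E_o P *v p4)) \<le>
      l4 * e4 + 2 * (s4 \<bullet> (C_o P *v (Q *v y) + D_o P *v (Y *v y) + G_o P *v w))"
    unfolding e4_def z4_def s4_def
    by (rule Lipschitz_channel_multipliers[OF l(4)]) (use pos p4 in \<open>simp_all add: g_def\<close>)
  ultimately show ?thesis
    unfolding \<kappa>_def by (simp add: inner_add_right right_diff_distrib)
qed

section \<open>Time nodes\<close>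

lemma node_0: "node P 0 = t_init P"
  by (simp add: node_def)

lemma node_last: "1 \<le> num_int P \<Longrightarrow> node P (num_int P) = t_final P"
  by (simp add: node_def)

lemma node_less_Suc: "t_init P < t_final P \<Longrightarrow> 1 \<le> num_int P \<Longrightarrow> node P k < node P (Suc k)"
  unfolding node_def by (intro add_strict_left_mono mult_strict_right_mono divide_strict_right_mono) auto

lemma node_mono: "t_init P < t_final P \<Longrightarrow> k \<le> l \<Longrightarrow> node P k \<le> node P l"
  unfolding node_def by (intro add_left_mono mult_right_mono divide_right_mono) auto

lemma seg_subset_horizon:
  assumes "t_init P < t_final P" "k < num_int P"
  shows "seg P k \<subseteq> horizon P"
  using node_mono[OF assms(1), of 0 k] node_mono[OF assms(1), of "Suc k" "num_int P"] assms(2)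
  by (auto simp: seg_def horizon_def node_0 node_last)

lemma seg_cover:
  assumes "0 < n" "t_init P \<le> t" "t \<le> node P n"
  shows "\<exists>k<n. t \<in> seg P k"
  using assms
proof (induction n)
  case (Suc n)
  show ?case
  proof (cases "0 < n \<and> t \<le> node P n")
    case True
    then show ?thesis using Suc by (meson less_SucI)
  next
    case False
    then have "node P n \<le> t" using Suc.prems by (cases "n = 0") (auto simp: node_0)
    then show ?thesis using Suc.prems by (auto simp: seg_def)
  qed
qed simp

section \<open>Invariance of the funnel\<close>

theorem theorem1:
  fixes P :: "('x::finite, 'u::finite, 'w::finite, 'q::finite, 'p::finite, 'e1::finite, 'e2::finite,
               'e3::finite, 'c1::finite, 'c2::finite, 'c3::finite) sdp_data"
    and v :: "('x, 'u, ('x, 'w, 'q, 'p, 'e1, 'e2, 'e3, 'c1, 'c2, 'c3) H_index) sdp_vars"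
    and f :: "real \<Rightarrow> real^'x \<Rightarrow> real^'u \<Rightarrow> real^'w \<Rightarrow> real^'x"
    and \<phi> :: "real \<Rightarrow> real^'q \<Rightarrow> real^'p"
    and At :: "real \<Rightarrow> real^'x^'x" and Bt :: "real \<Rightarrow> real^'u^'x" and Ft :: "real \<Rightarrow> real^'w^'x"
    and \<Delta>\<eta> :: "real \<Rightarrow> real^'c1^'e1" and \<Delta>\<xi> :: "real \<Rightarrow> real^'c2^'e2" and \<Delta>w :: "real \<Rightarrow> real^'c3^'e3"
    and Qs :: "(real^'q) set"
    and Q :: "real \<Rightarrow> real^'x^'x" and Y :: "real \<Rightarrow> real^'x^'u" and K :: "real \<Rightarrow> real^'x^'u"
  assumes times: "t_init P < t_final P" "1 \<le> num_int P"
    and f_cont: "\<forall>x u w. continuous_on (horizon P) (\<lambda>t. f t x u w)"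
    and f_C1: "\<forall>t\<in>horizon P. C1_map (\<lambda>(x, u, w). f t x u w)"
    and nominal: "piecewise_continuous_on (t_init P) (t_final P) (ubar P)"
      "solves_on f (t_init P) (t_final P) (xbar P) (ubar P) (\<lambda>_. 0)"
    and jac_A: "\<forall>t\<in>horizon P. ((\<lambda>x. f t x (ubar P t) 0) has_derivative (*v) (A_jac P t)) (at (xbar P t))"
    and jac_B: "\<forall>t\<in>horizon P. ((\<lambda>u. f t (xbar P t) u 0) has_derivative (*v) (B_jac P t)) (at (ubar P t))"
    and jac_F: "\<forall>t\<in>horizon P. ((\<lambda>w. f t (xbar P t) (ubar P t) w) has_derivative (*v) (F_jac P t)) (at 0)"
    and jac_bdd: "bounded (A_jac P ` horizon P)" "bounded (B_jac P ` horizon P)" "bounded (F_jac P ` horizon P)"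
    and f_form: "\<forall>t\<in>horizon P. \<forall>x u w. f t x u w =
      A_jac P t *v x + B_jac P t *v u + F_jac P t *v w + E_o P *v \<phi> t (q_out P x u w)"
    and interp: "is_foh P (\<lambda>k. A_jac P (node P k)) At" "is_foh P (\<lambda>k. B_jac P (node P k)) Bt"
      "is_foh P (\<lambda>k. F_jac P (node P k)) Ft"
    and interp_err: "\<forall>t\<in>horizon P. A_jac P t - At t = E_eta P ** \<Delta>\<eta> t ** C_eta P"
      "\<forall>t\<in>horizon P. B_jac P t - Bt t = E_xi P ** \<Delta>\<xi> t ** D_xi P"
      "\<forall>t\<in>horizon P. F_jac P t - Ft t = E_w P ** \<Delta>w t ** G_w P"
    and \<beta>_bound: "\<forall>t\<in>horizon P. 0 < beta_eta P t \<and> onorm ((*v) (\<Delta>\<eta> t)) \<le> beta_eta P t"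
      "\<forall>t\<in>horizon P. 0 < beta_xi P t \<and> onorm ((*v) (\<Delta>\<xi> t)) \<le> beta_xi P t"
      "\<forall>t\<in>horizon P. 0 < beta_w P t \<and> onorm ((*v) (\<Delta>w t)) \<le> beta_w P t"
    and \<gamma>_bound: "\<forall>t\<in>horizon P. \<forall>i. 0 < gam P t $ i \<and>
      (\<forall>q\<in>Qs. \<forall>q'\<in>Qs. \<bar>\<phi> t q $ i - \<phi> t q' $ i\<bar> \<le> gam P t $ i * norm (q - q'))"
    and sup_fin: "\<forall>k<num_int P. bdd_above (beta_eta P ` seg P k) \<and> bdd_above (beta_xi P ` seg P k) \<and>
      bdd_above (beta_w P ` seg P k) \<and> (\<forall>i. bdd_above ((\<lambda>t. gam P t $ i) ` seg P k))"
    and Qs: "compact Qs" "contains_outputs P f Q K Qs"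
    and params: "0 < lam_w P" "pd (Q_max P)" "convex_cost P"
    and sol: "sdp_solution P v"
    and foh_Q: "is_foh P (Q_var v) Q" and foh_Y: "is_foh P (Y_var v) Y"
    and gain: "\<forall>t\<in>horizon P. K t = Y t ** matrix_inv (Q t)"
  shows "\<forall>w x. closed_loop P f Q K w x \<longrightarrow>
           (\<forall>t\<in>horizon P. (x t, feedback P K x t) \<in> funnel P Q K t)"
proof (intro allI impI ballI)
  fix w x assume cl: "closed_loop P f Q K w x"
  let ?u = "feedback P K x"
  define \<eta> where "\<eta> t = x t - xbar P t" for t
  define \<eta>' where "\<eta>' t = f t (x t) (?u t) (w t) - f t (xbar P t) (ubar P t) 0" for t
  define V where "V t = \<eta> t \<bullet> (matrix_inv (Q t) *v \<eta> t)" for t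
  have feas: "sdp_feasible P v" using sol by (simp add: sdp_solution_def)
  have Qpd: "pd (Q_var v k)" if "k \<le> num_int P" for k
    using feas that by (auto simp: sdp_feasible_def)
  have cont: "continuous_on (horizon P) \<eta>"
    using cl nominal(2) unfolding closed_loop_def solves_on_def horizon_def \<eta>_def
    by (auto intro: continuous_on_diff)
  obtain S where S: "finite S"
    "\<And>t. t \<in> horizon P - S \<Longrightarrow> (\<eta> has_vector_derivative \<eta>' t) (at t within horizon P)"
  proof -
    obtain S1 where S1: "finite S1" "\<And>t. t \<in> horizon P - S1 \<Longrightarrow>
        (x has_vector_derivative f t (x t) (?u t) (w t)) (at t within horizon P)"
      using cl unfolding closed_loop_def solves_on_def horizon_def by blast
    obtain S2 where S2: "finite S2" "\<And>t. t \<in> horizon P - S2 \<Longrightarrow>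
        (xbar P has_vector_derivative f t (xbar P t) (ubar P t) 0) (at t within horizon P)"
      using nominal(2) unfolding solves_on_def horizon_def by blast
    show ?thesis
      using S1 S2 by (intro that[of "S1 \<union> S2"])
        (auto simp: \<eta>_def[abs_def] \<eta>'_def intro!: has_vector_derivative_diff)
  qed
  obtain Z where Z: "negligible Z"
    and w1: "\<And>t. t \<in> horizon P - Z \<Longrightarrow> norm (w t) \<le> 1"
    and qQs: "\<And>t. t \<in> horizon P - Z \<Longrightarrow> q_out P (x t) (?u t) (w t) \<in> Qs"
  proof -
    have "AE t in lebesgue_on {t_init P..t_final P}.
        norm (w t) \<le> 1 \<and> q_out P (x t) (?u t) (w t) \<in> Qs"
      using cl Qs(2) admissible_norm_le_1[of "t_init P" "t_final P" w]
      unfolding closed_loop_def contains_outputs_def horizon_def by (intro AE_conjI) auto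
    then show ?thesis
      by (rule AE_lebesgue_on_negligible) (use that in \<open>auto simp: horizon_def\<close>)
  qed
  have step: "V t \<le> 1" if k: "k < num_int P" and init: "V (node P k) \<le> 1" and t: "t \<in> seg P k" for k t
  proof -
    note seg = seg_subset_horizon[OF times(1) k]
    define h where "h = node P (Suc k) - node P k"
    have h: "h > 0" using node_less_Suc[OF times, of k] by (simp add: h_def)
    define \<sigma> where "\<sigma> s = (node P (Suc k) - s) / h" for s
    define \<tau> where "\<tau> s = (s - node P k) / h" for s
    have st: "0 \<le> \<sigma> s" "0 \<le> \<tau> s" "\<sigma> s + \<tau> s = 1" if "s \<in> seg P k" for s
      using that h by (auto simp: \<sigma>_def \<tau>_def seg_def h_def add_divide_distrib[symmetric])
    have foh: "g s = \<sigma> s *\<^sub>R M k + \<tau> s *\<^sub>R M (Suc k)" if "is_foh P M g" "s \<in> seg P k"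
      for M and g :: "real \<Rightarrow> 'z::real_vector" and s
      using that k by (simp add: is_foh_def \<sigma>_def \<tau>_def h_def)
    \<comment> \<open>Here \<open>Q1\<close> is the slope of \<open>Q\<close> on the interval and \<open>Q0\<close> its extrapolation to time zero.\<close>
    define Q1 where "Q1 = (1 / h) *\<^sub>R (Q_var v (Suc k) - Q_var v k)"
    define Q0 where "Q0 = Q_var v k - node P k *\<^sub>R Q1"
    have Q_affine: "Q s = Q0 + s *\<^sub>R Q1" if "s \<in> seg P k" for s
    proof -
      have \<sigma>: "\<sigma> s = 1 - \<tau> s" using st[OF that] by simp
      have "Q s = Q_var v k + \<tau> s *\<^sub>R (Q_var v (Suc k) - Q_var v k)"
        unfolding foh[OF foh_Q that] \<sigma> by (simp add: algebra_simps)
      also have "\<tau> s *\<^sub>R (Q_var v (Suc k) - Q_var v k) = (s - node P k) *\<^sub>R Q1"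
        by (simp add: Q1_def \<tau>_def)
      finally show ?thesis by (simp add: Q0_def algebra_simps)
    qed
    obtain c where c: "c > 0" and coercive: "\<And>s z. s \<in> seg P k \<Longrightarrow> c * (norm z)\<^sup>2 \<le> z \<bullet> (Q s *v z)"
    proof -
      obtain c where "c > 0" "\<And>\<sigma> \<tau> z. 0 \<le> \<sigma> \<Longrightarrow> 0 \<le> \<tau> \<Longrightarrow> \<sigma> + \<tau> = 1 \<Longrightarrow>
          c * (norm z)\<^sup>2 \<le> z \<bullet> ((\<sigma> *\<^sub>R Q_var v k + \<tau> *\<^sub>R Q_var v (Suc k)) *v z)"
        using pd_coercive_convex_combination[OF Qpd Qpd, of k "Suc k"] k by auto
      then show ?thesis using that[of c] foh[OF foh_Q] st by simp
    qed
    have sub: "{node P k..t} \<subseteq> seg P k" using t by (auto simp: seg_def)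
    have coercive': "c * (norm z)\<^sup>2 \<le> z \<bullet> ((Q0 + s *\<^sub>R Q1) *v z)" if "s \<in> {node P k..t}" for s z
      using coercive[of s z] Q_affine[of s] sub that by auto
    define y where "y s = matrix_inv (Q0 + s *\<^sub>R Q1) *v \<eta> s" for s
    have V_y: "V s = \<eta> s \<bullet> y s" if "s \<in> seg P k" for s
      using that by (simp add: V_def y_def Q_affine)
    have Qy: "Q s *v y s = \<eta> s" if "s \<in> seg P k" for s
      using coercive_matrix_inverse(1)[OF c coercive[OF that]] by (simp add: y_def Q_affine[OF that])
    \<comment> \<open>On the interval \<open>V\<close> is \<open>\<eta> \<bullet> y\<close>, which is differentiated through the affine formula for \<open>Q\<close>.\<close>
    have "\<eta> t \<bullet> y t \<le> 1"
    proof (rule sublevel_invariance[where V = "\<lambda>s. \<eta> s \<bullet> y s" and c = "lam_w P" and Z = Z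
          and V' = "\<lambda>s. 2 * (y s \<bullet> \<eta>' s) - y s \<bullet> (Q1 *v y s)"])
      show "node P k \<le> t" using t by (simp add: seg_def)
      have \<eta>cont: "continuous_on {node P k..t} \<eta>"
        using cont continuous_on_subset seg sub by blast
      have "continuous_on {node P k..t} y"
        unfolding y_def by (intro continuous_on_affine_inverse[OF c] coercive' \<eta>cont)
      then show "continuous_on {node P k..t} (\<lambda>s. \<eta> s \<bullet> y s)"
        by (intro continuous_intros \<eta>cont)
      show "finite S" "negligible Z" by fact+
      show "\<eta> (node P k) \<bullet> y (node P k) \<le> 1"
        using init V_y[of "node P k"] h by (simp add: seg_def h_def)
    next
      fix s assume s: "s \<in> {node P k<..<t} - S"
      then have s': "s \<in> {node P k..t}" "s \<in> seg P k" "s \<in> horizon P"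
        using subsetD[OF sub, of s] subsetD[OF seg, of s] by auto
      have d\<eta>: "(\<eta> has_vector_derivative \<eta>' s) (at s within {node P k..t})"
        using S(2)[of s] s s' sub seg by (blast intro: has_vector_derivative_within_subset)
      have dy: "(y has_vector_derivative matrix_inv (Q s) *v (\<eta>' s - Q1 *v y s)) (at s within {node P k..t})"
        unfolding y_def[abs_def] Q_affine[OF s'(2)]
        by (intro affine_inverse_has_vector_derivative[OF c] coercive' s'(1) d\<eta>)
      have "((\<lambda>s. \<eta> s \<bullet> y s) has_vector_derivative
          \<eta> s \<bullet> (matrix_inv (Q s) *v (\<eta>' s - Q1 *v y s)) + \<eta>' s \<bullet> y s) (at s within {node P k..t})"
        by (rule bounded_bilinear.has_vector_derivative[OF bounded_bilinear_inner d\<eta> dy])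
      also have "\<eta> s \<bullet> (matrix_inv (Q s) *v r) = y s \<bullet> r" for r
      proof -
        have "transpose (Q s) = Q s"
          using pd_convex_combination[OF Qpd Qpd st[OF s'(2)], of k "Suc k"] k
          by (simp add: foh[OF foh_Q s'(2)] pd_def)
        from inner_matrix_vector_symmetric[OF this, of "y s" "matrix_inv (Q s) *v r"] show ?thesis
          by (simp add: Qy[OF s'(2)] coercive_matrix_inverse(1)[OF c coercive[OF s'(2)]])
      qed
      finally show "((\<lambda>s. \<eta> s \<bullet> y s) has_vector_derivative 2 * (y s \<bullet> \<eta>' s) - y s \<bullet> (Q1 *v y s)) (at s)"
        using s by (simp add: at_within_Icc_at inner_diff_right inner_commute[of "\<eta>' s"])
    next
      fix s assume s: "s \<in> {node P k<..<t} - S - Z"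
      then have s': "s \<in> seg P k" "s \<in> horizon P" "s \<in> horizon P - Z"
        using subsetD[OF sub, of s] subsetD[OF seg, of s] by auto
      have \<xi>: "?u s - ubar P s = Y s *v y s"
        using gain s' by (simp add: feedback_def \<eta>_def[symmetric] matrix_vector_mul_assoc[symmetric]
            y_def Q_affine)
      \<comment> \<open>The uncertainty channels: interpolation errors of the Jacobians and increment of \<open>\<phi>\<close>.\<close>
      define p1 where "p1 = \<Delta>\<eta> s *v (C_eta P *v \<eta> s)"
      define p2 where "p2 = \<Delta>\<xi> s *v (D_xi P *v (Y s *v y s))"
      define p3 where "p3 = \<Delta>w s *v (G_w P *v w s)"
      define p4 where "p4 = \<phi> s (q_out P (x s) (?u s) (w s)) - \<phi> s (q_out P (xbar P s) (ubar P s) 0)"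
      have dq: "q_out P (x s) (?u s) (w s) - q_out P (xbar P s) (ubar P s) 0
          = C_o P *v \<eta> s + D_o P *v (Y s *v y s) + G_o P *v w s"
        unfolding \<xi>[symmetric] by (simp add: q_out_def \<eta>_def matrix_vector_mult_diff_distrib)
      have A: "A_jac P s *v \<eta> s = At s *v \<eta> s + E_eta P *v p1"
      proof -
        have "A_jac P s = At s + E_eta P ** \<Delta>\<eta> s ** C_eta P"
          using interp_err(1) s'(2) by (metis add_diff_cancel_left' diff_add_cancel add.commute)
        then show ?thesis
          by (simp add: p1_def matrix_vector_mult_add_rdistrib matrix_vector_mul_assoc[symmetric])
      qed
      have B: "B_jac P s *v (Y s *v y s) = Bt s *v (Y s *v y s) + E_xi P *v p2"
      proof -
        have "B_jac P s = Bt s + E_xi P ** \<Delta>\<xi> s ** D_xi P"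
          using interp_err(2) s'(2) by (metis add_diff_cancel_left' diff_add_cancel add.commute)
        then show ?thesis
          by (simp add: p2_def matrix_vector_mult_add_rdistrib matrix_vector_mul_assoc[symmetric])
      qed
      have F: "F_jac P s *v w s = Ft s *v w s + E_w P *v p3"
      proof -
        have "F_jac P s = Ft s + E_w P ** \<Delta>w s ** G_w P"
          using interp_err(3) s'(2) by (metis add_diff_cancel_left' diff_add_cancel add.commute)
        then show ?thesis
          by (simp add: p3_def matrix_vector_mult_add_rdistrib matrix_vector_mul_assoc[symmetric])
      qed
      have "\<eta>' s = A_jac P s *v \<eta> s + B_jac P s *v (Y s *v y s) + F_jac P s *v w s + E_o P *v p4"
        using f_form s'(2) unfolding \<xi>[symmetric]
        by (simp add: \<eta>'_def \<eta>_def p4_def matrix_vector_mult_diff_distrib)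
      then have \<eta>'_eq: "\<eta>' s = At s *v (Q s *v y s) + Bt s *v (Y s *v y s) + Ft s *v w s
          + E_eta P *v p1 + E_xi P *v p2 + E_w P *v p3 + E_o P *v p4"
        by (simp add: A B F Qy[OF s'(1)])
      have sup: "g s \<le> (SUP t\<in>seg P k. g t) \<and> 0 < (SUP t\<in>seg P k. g t)"
        if "0 < g s" "bdd_above (g ` seg P k)" for g :: "real \<Rightarrow> real"
        using cSUP_upper[OF s'(1), of g] that by simp
      have b1: "beta_eta P s \<le> (SUP t\<in>seg P k. beta_eta P t)" "0 < (SUP t\<in>seg P k. beta_eta P t)"
        using sup[of "beta_eta P"] \<beta>_bound(1) sup_fin k s'(2) by simp_all
      have b2: "beta_xi P s \<le> (SUP t\<in>seg P k. beta_xi P t)" "0 < (SUP t\<in>seg P k. beta_xi P t)"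
        using sup[of "beta_xi P"] \<beta>_bound(2) sup_fin k s'(2) by simp_all
      have b3: "beta_w P s \<le> (SUP t\<in>seg P k. beta_w P t)" "0 < (SUP t\<in>seg P k. beta_w P t)"
        using sup[of "beta_w P"] \<beta>_bound(3) sup_fin k s'(2) by simp_all
      have g: "gam P s $ i \<le> gam_sup P k $ i" "0 < gam_sup P k $ i" for i
        using sup[of "\<lambda>t. gam P t $ i"] \<gamma>_bound sup_fin k s'(2) by simp_all
      have p4: "\<bar>p4 $ i\<bar> \<le> gam_sup P k $ i * norm (C_o P *v \<eta> s + D_o P *v (Y s *v y s) + G_o P *v w s)" for i
      proof -
        have "q_out P (xbar P s) (ubar P s) 0 \<in> Qs"
          using Qs(2) s'(2) by (simp add: contains_outputs_def)
        then have "\<bar>p4 $ i\<bar> \<le> gam P s $ i * norm (C_o P *v \<eta> s + D_o P *v (Y s *v y s) + G_o P *v w s)"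
          using \<gamma>_bound s'(2) qQs[OF s'(3)] unfolding p4_def dq[symmetric] by simp
        also have "\<dots> \<le> gam_sup P k $ i * norm (C_o P *v \<eta> s + D_o P *v (Y s *v y s) + G_o P *v w s)"
          using g(1) by (rule mult_right_mono) simp
        finally show ?thesis .
      qed
      have "2 * (y s \<bullet> \<eta>' s) - y s \<bullet> (Q1 *v y s) \<le> lam_w P * (w s \<bullet> w s - y s \<bullet> (Q s *v y s))"
        unfolding \<eta>'_eq foh[OF interp(1) s'(1)] foh[OF interp(2) s'(1)] foh[OF interp(3) s'(1)]
          foh[OF foh_Q s'(1)] foh[OF foh_Y s'(1)] Q1_def h_def
      proof (rule dissipation_inequality)
        show "lmi_a P v k \<or> lmi_b P v k" using feas k by (simp add: sdp_feasible_def)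
        show "transpose (Q_var v j) = Q_var v j" if "j \<in> {k, Suc k}" for j
          using feas that k by (auto simp: sdp_feasible_def)
        show "0 < lam_beta_eta v j \<and> 0 < lam_beta_xi v j \<and> 0 < lam_beta_w v j \<and> 0 < lam_gam v j"
          if "j \<in> {k, Suc k}" for j
          using feas that k by (auto simp: sdp_feasible_def)
        show "0 \<le> \<sigma> s" "0 \<le> \<tau> s" "\<sigma> s + \<tau> s = 1" using st[OF s'(1)] by auto
        show "0 < (SUP t\<in>seg P k. beta_eta P t)" "0 < (SUP t\<in>seg P k. beta_xi P t)"
          "0 < (SUP t\<in>seg P k. beta_w P t)" "0 < gam_sup P k $ i" for i
          using b1 b2 b3 g by auto
        show "norm p1 \<le> (SUP t\<in>seg P k. beta_eta P t) *
            norm (C_eta P *v ((\<sigma> s *\<^sub>R Q_var v k + \<tau> s *\<^sub>R Q_var v (Suc k)) *v y s))"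
          unfolding foh[OF foh_Q s'(1), symmetric] Qy[OF s'(1)] p1_def
          using \<beta>_bound(1) s'(2) b1(1) norm_mult_le_of_onorm_le by blast
        show "norm p2 \<le> (SUP t\<in>seg P k. beta_xi P t) *
            norm (D_xi P *v ((\<sigma> s *\<^sub>R Y_var v k + \<tau> s *\<^sub>R Y_var v (Suc k)) *v y s))"
          unfolding foh[OF foh_Y s'(1), symmetric] p2_def
          using \<beta>_bound(2) s'(2) b2(1) norm_mult_le_of_onorm_le by blast
        show "norm p3 \<le> (SUP t\<in>seg P k. beta_w P t) * norm (G_w P *v w s)"
          unfolding p3_def using \<beta>_bound(3) s'(2) b3(1) norm_mult_le_of_onorm_le by blast
        show "\<bar>p4 $ i\<bar> \<le> gam_sup P k $ i *
            norm (C_o P *v ((\<sigma> s *\<^sub>R Q_var v k + \<tau> s *\<^sub>R Q_var v (Suc k)) *v y s)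
              + D_o P *v ((\<sigma> s *\<^sub>R Y_var v k + \<tau> s *\<^sub>R Y_var v (Suc k)) *v y s) + G_o P *v w s)" for i
          using p4[of i] unfolding foh[OF foh_Q s'(1), symmetric] foh[OF foh_Y s'(1), symmetric] Qy[OF s'(1)] .
      qed
      also have "\<dots> \<le> lam_w P * (1 - \<eta> s \<bullet> y s)"
      proof (rule mult_left_mono)
        have "w s \<bullet> w s \<le> 1"
          using power_mono[OF w1[OF s'(3)], of 2] by (simp add: power2_norm_eq_inner)
        then show "w s \<bullet> w s - y s \<bullet> (Q s *v y s) \<le> 1 - \<eta> s \<bullet> y s"
          by (simp add: Qy[OF s'(1)] inner_commute)
      qed (use params in simp)
      finally show "2 * (y s \<bullet> \<eta>' s) - y s \<bullet> (Q1 *v y s) \<le> lam_w P * (1 - \<eta> s \<bullet> y s)" .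
    qed
    then show ?thesis using V_y[OF t] by simp
  qed
  have V_node: "V (node P k) \<le> 1" if "k \<le> num_int P" for k
    using that
  proof (induction k)
    case 0
    then show ?case
      using cl by (auto simp: closed_loop_def state_ellipsoid_def V_def \<eta>_def node_0 elim!: set_plus_elim)
  next
    case (Suc k)
    then show ?case
      using step[of k "node P (Suc k)"] node_less_Suc[OF times, of k] by (simp add: seg_def)
  qed
  fix t assume t: "t \<in> horizon P"
  obtain k where k: "k < num_int P" "t \<in> seg P k"
    using seg_cover[of "num_int P" P t] t times(2) by (auto simp: horizon_def node_last)
  have \<eta>t: "\<eta> t \<in> state_ellipsoid (Q t)"
    using step[OF k(1) V_node k(2)] k(1) by (simp add: V_def state_ellipsoid_def)
  have "pd (Q t)"
  proof -
    let ?h = "node P (Suc k) - node P k"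
    have h: "?h > 0" using node_less_Suc[OF times, of k] by simp
    have "pd (((node P (Suc k) - t) / ?h) *\<^sub>R Q_var v k + ((t - node P k) / ?h) *\<^sub>R Q_var v (Suc k))"
      by (rule pd_convex_combination) (use k h in \<open>auto simp: Qpd seg_def add_divide_distrib[symmetric]\<close>)
    then show ?thesis using foh_Q k by (simp add: is_foh_def)
  qed
  from input_ellipsoid_of_state_ellipsoid[OF this \<eta>t]
  have "feedback P K x t \<in> {ubar P t} + input_ellipsoid (K t) (Q t)"
    by (auto simp: feedback_def \<eta>_def intro: set_plus_intro)
  moreover have "x t \<in> {xbar P t} + state_ellipsoid (Q t)"
    using set_plus_intro[OF singletonI \<eta>t, of "xbar P t"] by (simp add: \<eta>_def)
  ultimately show "(x t, feedback P K x t) \<in> funnel P Q K t"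
    by (simp add: funnel_def)
qed

end
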